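(* Let $\mathcal{L}=\sum_n \mathsf{L}(n,\mathbf{u}_0,\dots,\mathbf{u}_J)$ be a functional whose Lagrangian $\mathsf{L}$ is invariant under the action of a Lie group $G$, and let $\rho_0$ be (the base component of) a right difference moving frame for the action, with generating invariants $\boldsymbol{\kappa}=(\kappa^1,\dots,\kappa^p)$. Suppose that, in terms of these invariants and their shifts $\boldsymbol{\kappa}_j=\mathrm{S}_j\boldsymbol{\kappa}$, $$\mathcal{L}=\sum_n L(n,\boldsymbol{\kappa}_0,\dots,\boldsymbol{\kappa}_{J_1}),$$ and that the differential–difference syzygies are $$\frac{\mathrm{d}\boldsymbol{\kappa}}{\mathrm{d}t}=\mathcal{H}\boldsymbol{\sigma},$$ where $\boldsymbol{\sigma}=(\sigma^1,\dots,\sigma^q)$, $\sigma^\alpha=\rho_0\cdot (u_0^\alpha)'$, and $\mathcal{H}$ is a matrix of linear difference operators whose coefficients are functions of $\boldsymbol{\kappa}$ and its shifts. Then (with $\cdot$ denoting the sum over all components) $$\mathrm{E}_{\mathbf{u}}(\mathsf{L})\cdot\mathbf{u}_0'=\big(\mathcal{H}^*\mathrm{E}_{\boldsymbol{\kappa}}(L)\big)\cdot\boldsymbol{\sigma}.$$ Consequently, the invariantization of the original Euler–Lagrange equations is $$\iota_0\big(\mathrm{E}_{\mathbf{u}}(\mathsf{L})\big)=\mathcal{H}^*\mathrm{E}_{\boldsymbol{\kappa}}(L).$$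
   Context: Setting. The independent variable is $n\in\mathbb{Z}$; the dependent variables are $\mathbf{u}=(u^1,\dots,u^q)\in U\subset\mathbb{R}^q$, and $\mathbf{u}_j=\mathbf{u}(n+j)$. The shift operator is $\mathrm{S}:n\mapsto n+1$, $\mathrm{S}:u^\alpha_j\mapsto u^\alpha_{j+1}$, with powers $\mathrm{S}_j=\mathrm{S}^j$, $j\in\mathbb{Z}$; $\mathrm{id}$ is the identity operator. All calculations are formal (no convergence of sums is considered), local and smooth. Repeated indices are summed. For $J_0\le 0\le J$, the prolongation space $P_n^{(J_0,J)}(U)$ over the fixed arbitrary base point $n$ is the product of $J-J_0+1$ copies of $U$ with coordinates $z=(\mathbf{u}_{J_0},\dots,\mathbf{u}_J)$; prolongation spaces are taken as large as needed. Group action and frame. A Lie group $G$ of dimension $R$ acts smoothly (left action) on $U$ and diagonally on prolongation spaces, $g\cdot z=(g\cdot\mathbf{u}_{J_0},\dots,g\cdot\mathbf{u}_J)$; the action on the relevant prolongation space (or a suitable domain of it) is free and regular. A right moving frame is a map $\rho_0$ from (a domain in) the prolongation space to $G$ with $\rho_0(g\cdot z)=\rho_0(z)g^{-1}$, determined by a cross-section $\mathcal{K}_0$ transverse to the group orbits: $\rho_0(z)$ is the unique group element taking $z$ to $\mathcal{K}_0$. A difference moving frame is the sequence $\rho_k=\mathrm{S}_k\rho_0$ (with cross-sections $\mathcal{K}_k=\mathrm{S}_k\mathcal{K}_0$). The invariantization operator is $\iota_0(z)=\rho_0(z)\cdot z$, extended to functions by $\iota_0(f)(z)=f(\iota_0(z))$.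 A set of invariants is generating if every difference invariant is a function of its elements and their shifts. Variations. Let $\mathbf{u}=\mathbf{u}(t)$ depend smoothly on an auxiliary parameter $t$ (invariant under $G$), with $'=\mathrm{d}/\mathrm{d}t$; the action extends to derivatives by $g\cdot \mathbf{u}_j'=\mathrm{d}(g\cdot\mathbf{u}_j)/\mathrm{d}t$, and $\rho_0\cdot (u_0^\alpha)'=\big(\tfrac{\mathrm{d}}{\mathrm{d}t}(g\cdot u_0^\alpha)\big)\big|_{g=\rho_0}$ (the group element is held fixed while differentiating). Operators. The difference Euler operators are $\mathrm{E}_{u^\alpha}(\mathsf{L})=\sum_j\mathrm{S}_{-j}\big(\partial\mathsf{L}/\partial u^\alpha_j\big)$, $\mathrm{E}_{\mathbf{u}}=(\mathrm{E}_{u^1},\dots,\mathrm{E}_{u^q})$, and likewise $\mathrm{E}_{\kappa^\beta}(L)=\sum_j\mathrm{S}_{-j}\big(\partial L/\partial\kappa^\beta_j\big)$, treating the $\kappa^\beta_j$ as independent variables. The adjoint of a scalar linear difference operator $\mathcal{H}=\sum_j c_j\mathrm{S}_j$ is $\mathcal{H}^*(F)=\sum_j\mathrm{S}_{-j}(c_jF)$; for a matrix of operators, $(\mathcal{H}^* )_{\alpha\beta}=(\mathcal{H}_{\beta\alpha})^*$. *)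

theory Defs
  imports
    "HOL-Analysis.Analysis"
    "HOL-Algebra.Group_Action"
    "HOL-Library.Groups_Big_Fun"
begin

section \<open>Smooth maps and Lie groups\<close>

primrec Ck_on :: "nat \<Rightarrow> 'a::euclidean_space set \<Rightarrow> ('a \<Rightarrow> 'b::real_normed_vector) \<Rightarrow> bool" where
  "Ck_on 0 S f \<longleftrightarrow> continuous_on S f"
| "Ck_on (Suc k) S f \<longleftrightarrow> (\<forall>x\<in>S. f differentiable (at x)) \<and>
     (\<forall>b\<in>Basis. Ck_on k S (\<lambda>x. frechet_derivative f (at x) b))"

definition smooth_on :: "'a::euclidean_space set \<Rightarrow> ('a \<Rightarrow> 'b::real_normed_vector) \<Rightarrow> bool" where
  "smooth_on S f \<longleftrightarrow> open S \<and> (\<forall>k. Ck_on k S f)"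

text \<open>A chart is a pair \<open>(V, \<phi>)\<close> of an open set of the manifold and a coordinate map on it; the
  manifold is given by a topology and an atlas.\<close>

type_synonym ('g, 'r) chart = "'g set \<times> ('g \<Rightarrow> real ^ 'r)"

definition smooth_manifold :: "'g topology \<Rightarrow> ('g, 'r::finite) chart set \<Rightarrow> bool" where
  "smooth_manifold X A \<longleftrightarrow>
     Hausdorff_space X \<and> second_countable X \<and> (\<Union>(V, \<phi>)\<in>A. V) = topspace X \<and>
     (\<forall>(V, \<phi>)\<in>A. openin X V \<and> open (\<phi> ` V) \<and>
        homeomorphic_map (subtopology X V) (top_of_set (\<phi> ` V)) \<phi>) \<and>
     (\<forall>(V, \<phi>)\<in>A. \<forall>(W, \<psi>)\<in>A. smooth_on (\<phi> ` (V \<inter> W)) (\<lambda>y. \<psi> (the_inv_into V \<phi> y)))"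

text \<open>The dimension \<open>R\<close> of the group is \<open>CARD('r)\<close>.\<close>

definition lie_group :: "('g, 'm) monoid_scheme \<Rightarrow> 'g topology \<Rightarrow> ('g, 'r::finite) chart set \<Rightarrow> bool" where
  "lie_group G X A \<longleftrightarrow>
     group G \<and> topspace X = carrier G \<and> smooth_manifold X A \<and>
     continuous_map (prod_topology X X) X (\<lambda>(g, h). g \<otimes>\<^bsub>G\<^esub> h) \<and>
     continuous_map X X (\<lambda>g. inv\<^bsub>G\<^esub> g) \<and>
     (\<forall>(V1, \<phi>1)\<in>A. \<forall>(V2, \<phi>2)\<in>A. \<forall>(V3, \<phi>3)\<in>A.
        smooth_on ((\<lambda>(g, h). (\<phi>1 g, \<phi>2 h)) ` {(g, h). g \<in> V1 \<and> h \<in> V2 \<and> g \<otimes>\<^bsub>G\<^esub> h \<in> V3})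
          (\<lambda>(x, y). \<phi>3 (the_inv_into V1 \<phi>1 x \<otimes>\<^bsub>G\<^esub> the_inv_into V2 \<phi>2 y))) \<and>
     (\<forall>(V1, \<phi>1)\<in>A. \<forall>(V2, \<phi>2)\<in>A.
        smooth_on (\<phi>1 ` {g. g \<in> V1 \<and> inv\<^bsub>G\<^esub> g \<in> V2}) (\<lambda>x. \<phi>2 (inv\<^bsub>G\<^esub> (the_inv_into V1 \<phi>1 x))))"

text \<open>The library's \<^const>\<open>group_action\<close> is a left action by bijections of \<open>U\<close>.\<close>

definition smooth_action ::
  "('g, 'm) monoid_scheme \<Rightarrow> ('g, 'r::finite) chart set \<Rightarrow> (real ^ 'q) set \<Rightarrow>
     ('g \<Rightarrow> real ^ 'q \<Rightarrow> real ^ 'q) \<Rightarrow> bool" where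
  "smooth_action G A U act \<longleftrightarrow>
     open U \<and> group_action G U act \<and>
     (\<forall>(V, \<phi>)\<in>A. smooth_on (\<phi> ` V \<times> U) (\<lambda>(y, u). act (the_inv_into V \<phi> y) u))"

section \<open>Local functions on prolongation spaces\<close>

text \<open>A point of the prolongation spaces over the base point \<open>n\<close> is represented by the bilateral
  sequence \<open>z\<close> with \<open>z j = \<^bold>u\<^sub>j = \<^bold>u(n + j)\<close>. A subset of (a function on) \<open>P\<^sub>n\<close> with window
  \<open>(J0, J)\<close> is a set of sequences (a function of sequences) that only involves the entries with
  index in \<open>{J0..J}\<close>. A difference function \<open>f\<close> is a family \<open>f n z\<close> over all base points.\<close>

definition cylinder :: "int set \<Rightarrow> (int \<Rightarrow> 'a) set \<Rightarrow> bool" where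
  "cylinder W S \<longleftrightarrow> (\<forall>z\<in>S. \<forall>w. (\<forall>j\<in>W. w j = z j) \<longrightarrow> w \<in> S)"

definition depends_on :: "(int \<Rightarrow> 'a) set \<Rightarrow> int set \<Rightarrow> ((int \<Rightarrow> 'a) \<Rightarrow> 'b) \<Rightarrow> bool" where
  "depends_on S W f \<longleftrightarrow> (\<forall>z\<in>S. \<forall>w\<in>S. (\<forall>j\<in>W. w j = z j) \<longrightarrow> f w = f z)"

text \<open>The partial derivative \<open>\<partial>f / \<partial>u\<^sup>\<alpha>\<^sub>j\<close> at \<open>z\<close>.\<close>

definition pdiff :: "int \<Rightarrow> 'q::finite \<Rightarrow> ((int \<Rightarrow> real ^ 'q) \<Rightarrow> real) \<Rightarrow> (int \<Rightarrow> real ^ 'q) \<Rightarrow> real" where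
  "pdiff j \<alpha> f z = deriv (\<lambda>s. f (z(j := z j + s *\<^sub>R axis \<alpha> 1))) 0"

text \<open>\<open>C\<^sup>k\<close> in the usual sense that all iterated partial derivatives of order up to \<open>k\<close> exist and
  are continuous (for the product topology). It is applied to functions with a finite window, on
  sets \<open>S\<close> that are stable under small changes of finitely many entries.\<close>

primrec jet_Ck :: "nat \<Rightarrow> (int \<Rightarrow> real ^ 'q::finite) set \<Rightarrow> ((int \<Rightarrow> real ^ 'q) \<Rightarrow> real) \<Rightarrow> bool" where
  "jet_Ck 0 S f \<longleftrightarrow> continuous_on S f"
| "jet_Ck (Suc k) S f \<longleftrightarrow> continuous_on S f \<and>
     (\<forall>j \<alpha>. (\<forall>z\<in>S. (\<lambda>s. f (z(j := z j + s *\<^sub>R axis \<alpha> 1))) differentiable (at (0::real))) \<and>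
            jet_Ck k S (pdiff j \<alpha> f))"

definition jet_smooth :: "(int \<Rightarrow> real ^ 'q::finite) set \<Rightarrow> int set \<Rightarrow> ((int \<Rightarrow> real ^ 'q) \<Rightarrow> real) \<Rightarrow> bool" where
  "jet_smooth S W f \<longleftrightarrow> depends_on S W f \<and> (\<forall>k. jet_Ck k S f)"

text \<open>Smooth functions \<open>f(n, \<^bold>u\<^sub>a, \<dots>, \<^bold>u\<^sub>b)\<close> over the domains \<open>D n\<close>; the window does not depend
  on \<open>n\<close>.\<close>

definition smooth_fun ::
  "(int \<Rightarrow> (int \<Rightarrow> real ^ 'q::finite) set) \<Rightarrow> int \<Rightarrow> int \<Rightarrow> (int \<Rightarrow> (int \<Rightarrow> real ^ 'q) \<Rightarrow> real) \<Rightarrow> bool" where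
  "smooth_fun D a b f \<longleftrightarrow> (\<forall>n. jet_smooth (D n) {a..b} (f n))"

definition difference_fun ::
  "(int \<Rightarrow> (int \<Rightarrow> real ^ 'q::finite) set) \<Rightarrow> (int \<Rightarrow> (int \<Rightarrow> real ^ 'q) \<Rightarrow> real) \<Rightarrow> bool" where
  "difference_fun D f \<longleftrightarrow> (\<exists>a b. smooth_fun D a b f)"

section \<open>Difference operators\<close>

definition shift :: "int \<Rightarrow> (int \<Rightarrow> 'a) \<Rightarrow> int \<Rightarrow> 'a" where
  "shift k z = (\<lambda>j. z (j + k))"

text \<open>The operator \<open>S\<^sub>k\<close>: \<open>n \<mapsto> n + k\<close>, \<open>\<^bold>u\<^sub>j \<mapsto> \<^bold>u\<^sub>j\<^sub>+\<^sub>k\<close>. It applies to real-valued functions, to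
  group-valued functions and, with \<open>'a\<close> the type of curves \<open>t \<mapsto> \<^bold>u\<^sub>j(t)\<close>, to functions of
  variations.\<close>

definition Sh :: "int \<Rightarrow> (int \<Rightarrow> (int \<Rightarrow> 'a) \<Rightarrow> 'b) \<Rightarrow> int \<Rightarrow> (int \<Rightarrow> 'a) \<Rightarrow> 'b" where
  "Sh k f n z = f (n + k) (shift k z)"

text \<open>\<open>c\<close> stands for the scalar operator \<open>\<Sum>\<^sub>j c\<^sub>j S\<^sub>j\<close>. \<^const>\<open>Sum_any\<close> is the sum over
  the indices with non-zero summand; in all uses below there are finitely many.\<close>

type_synonym 'a dop = "int \<Rightarrow> int \<Rightarrow> (int \<Rightarrow> 'a) \<Rightarrow> real"

definition difference_op :: "(int \<Rightarrow> (int \<Rightarrow> real ^ 'p::finite) set) \<Rightarrow> (real ^ 'p) dop \<Rightarrow> bool" where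
  "difference_op D c \<longleftrightarrow> finite {j. c j \<noteq> (\<lambda>n z. 0)} \<and> (\<forall>j. difference_fun D (c j))"

definition app_op :: "'a dop \<Rightarrow> (int \<Rightarrow> (int \<Rightarrow> 'a) \<Rightarrow> real) \<Rightarrow> int \<Rightarrow> (int \<Rightarrow> 'a) \<Rightarrow> real" where
  "app_op c F n z = Sum_any (\<lambda>j. c j n z * Sh j F n z)"

definition app_adjoint :: "'a dop \<Rightarrow> (int \<Rightarrow> (int \<Rightarrow> 'a) \<Rightarrow> real) \<Rightarrow> int \<Rightarrow> (int \<Rightarrow> 'a) \<Rightarrow> real" where
  "app_adjoint c F n z = Sum_any (\<lambda>j. Sh (-j) (\<lambda>m w. c j m w * F m w) n z)"

text \<open>For \<open>H = (H\<^sub>\<beta>\<^sub>\<alpha>)\<close>: the components \<open>(H F)\<^sub>\<beta>\<close> and \<open>(H\<^sup>* F)\<^sub>\<alpha>\<close>.\<close>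

definition app_matrix ::
  "('p \<Rightarrow> 'q::finite \<Rightarrow> 'a dop) \<Rightarrow> ('q \<Rightarrow> int \<Rightarrow> (int \<Rightarrow> 'a) \<Rightarrow> real) \<Rightarrow>
     'p \<Rightarrow> int \<Rightarrow> (int \<Rightarrow> 'a) \<Rightarrow> real" where
  "app_matrix H F \<beta> n z = (\<Sum>\<alpha>\<in>UNIV. app_op (H \<beta> \<alpha>) (F \<alpha>) n z)"

definition app_matrix_adjoint ::
  "('p::finite \<Rightarrow> 'q \<Rightarrow> 'a dop) \<Rightarrow> ('p \<Rightarrow> int \<Rightarrow> (int \<Rightarrow> 'a) \<Rightarrow> real) \<Rightarrow>
     'q \<Rightarrow> int \<Rightarrow> (int \<Rightarrow> 'a) \<Rightarrow> real" where
  "app_matrix_adjoint H F \<alpha> n z = (\<Sum>\<beta>\<in>UNIV. app_adjoint (H \<beta> \<alpha>) (F \<beta>) n z)"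

definition euler ::
  "'q::finite \<Rightarrow> (int \<Rightarrow> (int \<Rightarrow> real ^ 'q) \<Rightarrow> real) \<Rightarrow> int \<Rightarrow> (int \<Rightarrow> real ^ 'q) \<Rightarrow> real" where
  "euler \<alpha> f n z = Sum_any (\<lambda>j. Sh (-j) (\<lambda>m. pdiff j \<alpha> (f m)) n z)"

text \<open>The formal sums over all \<open>n\<close> of \<open>f\<close> and \<open>g\<close> define the same functional: \<open>f\<close> and
  \<open>g\<close> differ by a total difference \<open>(S - id) A\<close> (in particular if \<open>f = g\<close>).\<close>

definition same_functional ::
  "(int \<Rightarrow> (int \<Rightarrow> real ^ 'q::finite) set) \<Rightarrow> (int \<Rightarrow> (int \<Rightarrow> real ^ 'q) \<Rightarrow> real) \<Rightarrow>
     (int \<Rightarrow> (int \<Rightarrow> real ^ 'q) \<Rightarrow> real) \<Rightarrow> bool" where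
  "same_functional D f g \<longleftrightarrow>
     (\<exists>A. difference_fun D A \<and> (\<forall>n. \<forall>z\<in>D n. f n z = g n z + (Sh 1 A n z - A n z)))"

section \<open>Difference moving frames\<close>

definition diag :: "('g \<Rightarrow> 'a \<Rightarrow> 'a) \<Rightarrow> 'g \<Rightarrow> (int \<Rightarrow> 'a) \<Rightarrow> int \<Rightarrow> 'a" where
  "diag act g z = (\<lambda>j. act g (z j))"

text \<open>\<open>\<Omega> n\<close> is a \<open>G\<close>-invariant open domain in \<open>P\<^sub>n\<close> with window \<open>(J0, J)\<close>.\<close>

definition invariant_domain ::
  "('g, 'm) monoid_scheme \<Rightarrow> (real ^ 'q) set \<Rightarrow> ('g \<Rightarrow> real ^ 'q \<Rightarrow> real ^ 'q) \<Rightarrow> int \<Rightarrow> int \<Rightarrow>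
     (int \<Rightarrow> (int \<Rightarrow> real ^ 'q::finite) set) \<Rightarrow> bool" where
  "invariant_domain G U act J0 J \<Omega> \<longleftrightarrow>
     J0 \<le> 0 \<and> 0 \<le> J \<and>
     (\<forall>n. open (\<Omega> n) \<and> cylinder {J0..J} (\<Omega> n) \<and> \<Omega> n \<subseteq> {z. \<forall>j\<in>{J0..J}. z j \<in> U} \<and>
        (\<forall>g\<in>carrier G. \<forall>z\<in>\<Omega> n. diag act g z \<in> \<Omega> n))"

definition free_on ::
  "('g, 'm) monoid_scheme \<Rightarrow> ('g \<Rightarrow> 'a \<Rightarrow> 'a) \<Rightarrow> int set \<Rightarrow> (int \<Rightarrow> 'a) set \<Rightarrow> bool" where
  "free_on G act W S \<longleftrightarrow>
     (\<forall>z\<in>S. \<forall>g\<in>carrier G. (\<forall>j\<in>W. diag act g z j = z j) \<longrightarrow> g = \<one>\<^bsub>G\<^esub>)"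

text \<open>Regularity: every point has arbitrarily small neighbourhoods that meet each orbit in a
  pathwise connected set. (That all orbits have the same dimension follows from freeness.)
  Neighbourhoods and orbits are represented by the corresponding cylinders.\<close>

definition regular_on ::
  "('g, 'm) monoid_scheme \<Rightarrow> ('g \<Rightarrow> 'a::topological_space \<Rightarrow> 'a) \<Rightarrow> int set \<Rightarrow> (int \<Rightarrow> 'a) set \<Rightarrow> bool" where
  "regular_on G act W S \<longleftrightarrow>
     (\<forall>z\<in>S. \<forall>N. open N \<and> cylinder W N \<and> z \<in> N \<longrightarrow>
        (\<exists>N'. open N' \<and> cylinder W N' \<and> z \<in> N' \<and> N' \<subseteq> N \<inter> S \<and>
           (\<forall>w\<in>S. path_connected (N' \<inter> {x. \<exists>g\<in>carrier G. \<forall>j\<in>W. x j = diag act g w j}))))"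

text \<open>\<open>K\<close> is a submanifold of \<open>S\<close> that is transverse to the group orbits and of complementary
  dimension \<open>R\<close>: near each of its points \<open>z\<close> it is the zero set of \<open>R\<close> smooth functions
  \<open>\<psi>\<^sub>r\<close> such that the derivative of \<open>g \<mapsto> (\<psi>\<^sub>r(g \<cdot> z))\<^sub>r\<close> at the identity is bijective.\<close>

definition transverse_cross_section ::
  "('g, 'm) monoid_scheme \<Rightarrow> ('g, 'r::finite) chart set \<Rightarrow>
     ('g \<Rightarrow> real ^ 'q::finite \<Rightarrow> real ^ 'q) \<Rightarrow> int set \<Rightarrow>
     (int \<Rightarrow> real ^ 'q) set \<Rightarrow> (int \<Rightarrow> real ^ 'q) set \<Rightarrow> bool" where
  "transverse_cross_section G A act W S K \<longleftrightarrow>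
     K \<subseteq> S \<and> cylinder W K \<and>
     (\<forall>z\<in>K. \<exists>N (\<psi> :: 'r \<Rightarrow> (int \<Rightarrow> real ^ 'q) \<Rightarrow> real).
        open N \<and> cylinder W N \<and> z \<in> N \<and> N \<subseteq> S \<and>
        (\<forall>r. jet_smooth N W (\<psi> r)) \<and> K \<inter> N = {w\<in>N. \<forall>r. \<psi> r w = 0} \<and>
        (\<forall>(V, \<phi>)\<in>A. \<one>\<^bsub>G\<^esub> \<in> V \<longrightarrow>
           bij (frechet_derivative (\<lambda>y. \<chi> r. \<psi> r (diag act (the_inv_into V \<phi> y) z)) (at (\<phi> \<one>\<^bsub>G\<^esub>)))))"

text \<open>\<open>\<rho> n\<close> is the base component \<open>\<rho>\<^sub>0\<close> of the frame over the base point \<open>n\<close>, and the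
  difference moving frame is the sequence \<open>\<rho>\<^sub>k = Sh k \<rho>\<close> with cross-sections \<open>K (n + k)\<close>.\<close>

definition right_moving_frame ::
  "('g, 'm) monoid_scheme \<Rightarrow> 'g topology \<Rightarrow> ('g, 'r::finite) chart set \<Rightarrow>
     ('g \<Rightarrow> real ^ 'q::finite \<Rightarrow> real ^ 'q) \<Rightarrow> int \<Rightarrow> int \<Rightarrow>
     (int \<Rightarrow> (int \<Rightarrow> real ^ 'q) set) \<Rightarrow> (int \<Rightarrow> (int \<Rightarrow> real ^ 'q) set) \<Rightarrow>
     (int \<Rightarrow> (int \<Rightarrow> real ^ 'q) \<Rightarrow> 'g) \<Rightarrow> bool" where
  "right_moving_frame G X A act J0 J \<Omega> K \<rho> \<longleftrightarrow>
     (\<forall>n. transverse_cross_section G A act {J0..J} (\<Omega> n) (K n) \<and>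
        depends_on (\<Omega> n) {J0..J} (\<rho> n) \<and>
        continuous_map (top_of_set (\<Omega> n)) X (\<rho> n) \<and>
        (\<forall>(V, \<phi>)\<in>A. \<forall>i. jet_smooth {z\<in>\<Omega> n. \<rho> n z \<in> V} {J0..J} (\<lambda>z. \<phi> (\<rho> n z) $ i)) \<and>
        (\<forall>z\<in>\<Omega> n. \<rho> n z \<in> carrier G \<and> diag act (\<rho> n z) z \<in> K n \<and>
           (\<forall>g\<in>carrier G. diag act g z \<in> K n \<longrightarrow> g = \<rho> n z)) \<and>
        (\<forall>z\<in>\<Omega> n. \<forall>g\<in>carrier G. \<rho> n (diag act g z) = \<rho> n z \<otimes>\<^bsub>G\<^esub> inv\<^bsub>G\<^esub> g))"

text \<open>The points at which all \<open>\<rho>\<^sub>k\<close> are defined.\<close>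

definition frame_domain :: "(int \<Rightarrow> (int \<Rightarrow> 'a) set) \<Rightarrow> int \<Rightarrow> (int \<Rightarrow> 'a) set" where
  "frame_domain \<Omega> n = {z. \<forall>k. shift k z \<in> \<Omega> (n + k)}"

text \<open>The invariantization \<open>\<iota>\<^sub>0\<close>.\<close>

definition invariantize ::
  "('g \<Rightarrow> 'a \<Rightarrow> 'a) \<Rightarrow> (int \<Rightarrow> (int \<Rightarrow> 'a) \<Rightarrow> 'g) \<Rightarrow> (int \<Rightarrow> (int \<Rightarrow> 'a) \<Rightarrow> 'b) \<Rightarrow> int \<Rightarrow> (int \<Rightarrow> 'a) \<Rightarrow> 'b" where
  "invariantize act \<rho> f n z = f n (diag act (\<rho> n z) z)"

section \<open>Invariants and syzygies\<close>

definition invariant_fun ::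
  "('g, 'm) monoid_scheme \<Rightarrow> ('g \<Rightarrow> 'a \<Rightarrow> 'a) \<Rightarrow> (int \<Rightarrow> (int \<Rightarrow> 'a) set) \<Rightarrow>
     (int \<Rightarrow> (int \<Rightarrow> 'a) \<Rightarrow> 'b) \<Rightarrow> bool" where
  "invariant_fun G act D f \<longleftrightarrow> (\<forall>n. \<forall>z\<in>D n. \<forall>g\<in>carrier G. f n (diag act g z) = f n z)"

text \<open>\<open>\<kappa>_jet \<kappa> n z\<close> is the sequence of the \<open>\<^bold>\<kappa>\<^sub>j = S\<^sub>j \<^bold>\<kappa>\<close>, and \<open>in_terms_of \<kappa> f\<close> is
  \<open>f(n, \<dots>, \<^bold>\<kappa>\<^sub>0, \<^bold>\<kappa>\<^sub>1, \<dots>)\<close> as a function of \<open>\<^bold>u\<close> and its shifts.\<close>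

definition \<kappa>_jet ::
  "('p::finite \<Rightarrow> int \<Rightarrow> (int \<Rightarrow> 'a) \<Rightarrow> real) \<Rightarrow> int \<Rightarrow> (int \<Rightarrow> 'a) \<Rightarrow> int \<Rightarrow> real ^ 'p" where
  "\<kappa>_jet \<kappa> n z = (\<lambda>j. \<chi> \<beta>. Sh j (\<kappa> \<beta>) n z)"

definition in_terms_of ::
  "('p::finite \<Rightarrow> int \<Rightarrow> (int \<Rightarrow> 'a) \<Rightarrow> real) \<Rightarrow> (int \<Rightarrow> (int \<Rightarrow> real ^ 'p) \<Rightarrow> 'b) \<Rightarrow>
     int \<Rightarrow> (int \<Rightarrow> 'a) \<Rightarrow> 'b" where
  "in_terms_of \<kappa> f n z = f n (\<kappa>_jet \<kappa> n z)"

definition generating_invariants ::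
  "('g, 'm) monoid_scheme \<Rightarrow> ('g \<Rightarrow> real ^ 'q::finite \<Rightarrow> real ^ 'q) \<Rightarrow>
     (int \<Rightarrow> (int \<Rightarrow> real ^ 'q) set) \<Rightarrow> ('p::finite \<Rightarrow> int \<Rightarrow> (int \<Rightarrow> real ^ 'q) \<Rightarrow> real) \<Rightarrow> bool" where
  "generating_invariants G act D \<kappa> \<longleftrightarrow>
     (\<forall>\<beta>. difference_fun D (\<kappa> \<beta>) \<and> invariant_fun G act D (\<kappa> \<beta>)) \<and>
     (\<forall>f. difference_fun D f \<and> invariant_fun G act D f \<longrightarrow>
        (\<exists>F a b. (\<forall>n. depends_on UNIV {a..b} (F n)) \<and>
                 (\<forall>n. \<forall>z\<in>D n. f n z = in_terms_of \<kappa> F n z)))"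

text \<open>A variation over the base point \<open>n\<close> is a sequence \<open>\<zeta>\<close> of smooth curves
  \<open>\<zeta> j t = \<^bold>u\<^sub>j(t)\<close>.\<close>

definition at_time :: "real \<Rightarrow> (int \<Rightarrow> real \<Rightarrow> 'a) \<Rightarrow> int \<Rightarrow> 'a" where
  "at_time t \<zeta> = (\<lambda>j. \<zeta> j t)"

definition variation ::
  "(int \<Rightarrow> (int \<Rightarrow> real ^ 'q::finite) set) \<Rightarrow> int \<Rightarrow> (int \<Rightarrow> real \<Rightarrow> real ^ 'q) \<Rightarrow> bool" where
  "variation D n \<zeta> \<longleftrightarrow> (\<forall>j. smooth_on UNIV (\<zeta> j)) \<and> (\<forall>t. at_time t \<zeta> \<in> D n)"

text \<open>\<open>\<sigma>\<^sup>\<alpha> = \<rho>\<^sub>0 \<cdot> (u\<^sup>\<alpha>\<^sub>0)'\<close> at time \<open>t\<close>: the group element is frozen at its value at \<open>t\<close>.\<close>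

definition \<sigma>_inv ::
  "('g \<Rightarrow> real ^ 'q::finite \<Rightarrow> real ^ 'q) \<Rightarrow> (int \<Rightarrow> (int \<Rightarrow> real ^ 'q) \<Rightarrow> 'g) \<Rightarrow> real \<Rightarrow>
     'q \<Rightarrow> int \<Rightarrow> (int \<Rightarrow> real \<Rightarrow> real ^ 'q) \<Rightarrow> real" where
  "\<sigma>_inv act \<rho> t \<alpha> n \<zeta> =
     vector_derivative (\<lambda>s. act (\<rho> n (at_time t \<zeta>)) (\<zeta> 0 s)) (at t) $ \<alpha>"

text \<open>The differential-difference syzygies \<open>d\<^bold>\<kappa>/dt = H \<sigma>\<close> along all variations; the
  coefficients of \<open>H\<close> are functions of \<open>\<^bold>\<kappa>\<close> and its shifts.\<close>

definition syzygies ::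
  "('g \<Rightarrow> real ^ 'q::finite \<Rightarrow> real ^ 'q) \<Rightarrow> (int \<Rightarrow> (int \<Rightarrow> real ^ 'q) set) \<Rightarrow>
     (int \<Rightarrow> (int \<Rightarrow> real ^ 'q) \<Rightarrow> 'g) \<Rightarrow> ('p::finite \<Rightarrow> int \<Rightarrow> (int \<Rightarrow> real ^ 'q) \<Rightarrow> real) \<Rightarrow>
     ('p \<Rightarrow> 'q \<Rightarrow> (real ^ 'p) dop) \<Rightarrow> bool" where
  "syzygies act D \<rho> \<kappa> H \<longleftrightarrow>
     (\<forall>n \<zeta> t \<beta>. variation D n \<zeta> \<longrightarrow>
        ((\<lambda>s. \<kappa> \<beta> n (at_time s \<zeta>)) has_real_derivative
           app_matrix (\<lambda>\<beta> \<alpha> j m \<xi>. in_terms_of \<kappa> (H \<beta> \<alpha> j) m (at_time t \<xi>)) (\<sigma>_inv act \<rho> t) \<beta> n \<zeta>)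
          (at t))"

end

theory Submission
  imports Defs
begin

text \<open>
  The textbook argument differentiates both forms of the Lagrangian along a variation, sums by
  parts, and compares the coefficients of the arbitrary variation \<open>\<^bold>u'\<close>, discarding total
  differences. Here the comparison is made exact by a choice of variation: fix \<open>z \<in> D n\<close> and let
  only the component \<open>\<alpha>\<close> of the entry \<open>\<^bold>u\<^sub>0\<close> vary, with unit speed at time \<open>0\<close>. Three things then
  happen.

  \<^item> The sum of the Lagrangian over the base points \<open>n + m\<close>, \<open>-M \<le> m < M\<close>, sees the varying entry
    at finitely many base points only, so for large \<open>M\<close> its derivative at time \<open>0\<close> is exactly the
    sum that defines \<open>E\<^sub>u\<^sup>\<alpha>(LL)\<close> at \<open>z\<close>.

  \<^item> The total difference by which \<open>LL\<close> and \<open>L(\<^bold>\<kappa>)\<close> may differ telescopes to boundary terms at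
    \<open>n \<plusminus> M\<close>. These do not involve \<open>\<^bold>u\<^sub>0\<close>, hence are constant along the variation. So
    \<open>E\<^sub>u\<^sup>\<alpha>(LL)\<close> is also the derivative of the finite sum of the \<open>L(\<^bold>\<kappa>)\<close>. The chain rule and a
    reindexing (the summation by parts) turn this into \<open>\<Sum>\<^sub>i \<Sum>\<^sub>\<beta> S\<^sub>i(E\<^sub>\<kappa>\<^sup>\<beta>(L)) (\<kappa>\<^sup>\<beta>\<^sub>i)'\<close>.

  \<^item> In the syzygies only the entry \<open>0\<close> moves, so of all shifts of \<open>\<sigma>\<close> only \<open>\<sigma>\<close> itself survives:
    \<open>(\<kappa>\<^sup>\<beta>\<^sub>i)'\<close> is \<open>S\<^sub>i\<close> of the coefficient of \<open>S\<^sub>-\<^sub>i\<close> in \<open>H\<close>, times \<open>\<sigma>\<close>. Substituting this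
    produces the adjoint operator and gives \<open>E\<^sub>u\<^sup>\<alpha>(LL) = H\<^sup>*E\<^sub>\<kappa>(L) \<cdot> \<sigma>\<close> for these special
    variations; this is the lemma \<open>euler_via_invariants\<close>.

  Both parts of the theorem follow pointwise. For an arbitrary variation, \<open>\<sigma>\<close> is the image of
  \<open>\<^bold>u\<^sub>0'\<close> under the derivative of the action of the frame element, so the identity extends by
  linearity from the axis directions. For the invariantization, evaluate at \<open>w = \<rho>\<^sub>0(z) \<cdot> z\<close>:
  there the frame is the identity by equivariance, hence \<open>\<sigma>\<close> is the axis vector itself, and the
  invariants have the same values at \<open>w\<close> as at \<open>z\<close>.
\<close>

section \<open>Differentiation of functions of finitely many sequence entries\<close>

lemma tendsto_coordinatewise:
  fixes f :: "'b \<Rightarrow> 'i \<Rightarrow> 'a::topological_space"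
  assumes "\<And>i. ((\<lambda>t. f t i) \<longlongrightarrow> l i) F"
  shows "(f \<longlongrightarrow> l) F"
proof -
  have "limitin (product_topology (\<lambda>i. euclidean) UNIV) f l F"
    using assms by (simp add: limitin_componentwise)
  then show ?thesis
    by (simp add: euclidean_product_topology)
qed

lemma tendsto_nudge:
  fixes w :: "'b \<Rightarrow> int \<Rightarrow> 'a::real_normed_vector"
  assumes w: "\<And>i. ((\<lambda>t. w t i) \<longlongrightarrow> z i) F" and v: "(v \<longlongrightarrow> 0) F"
  shows "((\<lambda>t. (w t)(j := w t j + v t)) \<longlongrightarrow> z) F"
proof (rule tendsto_coordinatewise)
  fix i
  show "((\<lambda>t. ((w t)(j := w t j + v t)) i) \<longlongrightarrow> z i) F"
    using tendsto_add[OF w[of j] v] w[of i] by (cases "i = j") auto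
qed

lemma jet_has_derivative_partial:
  assumes "jet_Ck (Suc k) S f" "z(j := z j + s *\<^sub>R axis \<beta> 1) \<in> S"
  shows "((\<lambda>s. f (z(j := z j + s *\<^sub>R axis \<beta> 1))) has_real_derivative
           pdiff j \<beta> f (z(j := z j + s *\<^sub>R axis \<beta> 1))) (at s)"
proof -
  let ?w = "z(j := z j + s *\<^sub>R axis \<beta> 1)"
  have shift_line: "?w(j := ?w j + r *\<^sub>R axis \<beta> 1) = z(j := z j + (r + s) *\<^sub>R axis \<beta> 1)" for r
    by (simp add: scaleR_add_left add.commute add.left_commute)
  have "\<forall>w\<in>S. (\<lambda>r. f (w(j := w j + r *\<^sub>R axis \<beta> 1))) differentiable (at (0::real))"
    using assms(1) by simp
  then have "(\<lambda>r. f (?w(j := ?w j + r *\<^sub>R axis \<beta> 1))) differentiable (at (0::real))"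
    using assms(2) by blast
  then have "((\<lambda>r. f (?w(j := ?w j + r *\<^sub>R axis \<beta> 1))) has_real_derivative pdiff j \<beta> f ?w) (at 0)"
    unfolding pdiff_def by (metis DERIV_deriv_iff_real_differentiable)
  then have "((\<lambda>r. f (z(j := z j + (r + s) *\<^sub>R axis \<beta> 1))) has_real_derivative pdiff j \<beta> f ?w) (at 0)"
    unfolding shift_line .
  then show ?thesis
    using DERIV_shift[of "\<lambda>s. f (z(j := z j + s *\<^sub>R axis \<beta> 1))" "pdiff j \<beta> f ?w" 0 s] by simp
qed

lemma tendsto_move_coordinates:
  fixes x :: "real \<Rightarrow> int \<Rightarrow> real ^ 'q::finite"
  assumes "\<And>j \<beta>. isCont (\<lambda>t. x t j $ \<beta>) t0"
  shows "((\<lambda>t. \<chi> \<gamma>. if (i, \<gamma>) \<in> C then x t i $ \<gamma> else x t0 i $ \<gamma>) \<longlongrightarrow> x t0 i) (nhds t0)"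
proof (rule vec_tendstoI)
  fix \<gamma>
  have "((\<lambda>t. x t i $ \<gamma>) \<longlongrightarrow> x t0 i $ \<gamma>) (nhds t0)"
    using assms[of i \<gamma>] tendsto_at_iff_tendsto_nhds[of "\<lambda>t. x t i $ \<gamma>" t0] by (simp add: isCont_def)
  then show "((\<lambda>t. (\<chi> \<gamma>. if (i, \<gamma>) \<in> C then x t i $ \<gamma> else x t0 i $ \<gamma>) $ \<gamma>) \<longlongrightarrow> x t0 i $ \<gamma>) (nhds t0)"
    by (cases "(i, \<gamma>) \<in> C") simp_all
qed

text \<open>The classical proof that continuous partial derivatives give a chain rule. The coordinates in
  \<open>C\<close> are released one at a time; each release changes \<open>f\<close> by a one-dimensional increment, which the
  mean value inequality compares with the partial derivative at the limit point. All limits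
  are taken in the product topology on sequences, that is, coordinatewise.\<close>

lemma jet_chain_rule_coordinates:
  fixes f :: "(int \<Rightarrow> real ^ 'q::finite) \<Rightarrow> real" and x :: "real \<Rightarrow> int \<Rightarrow> real ^ 'q"
  assumes f: "jet_Ck (Suc 0) S f" and S: "open S" "x t0 \<in> S" and C: "finite C"
    and x: "\<And>j \<beta>. ((\<lambda>t. x t j $ \<beta>) has_real_derivative x' j \<beta>) (at t0)"
  shows "((\<lambda>t. f (\<lambda>j. \<chi> \<beta>. if (j, \<beta>) \<in> C then x t j $ \<beta> else x t0 j $ \<beta>)) has_real_derivative
           (\<Sum>(j, \<beta>)\<in>C. pdiff j \<beta> f (x t0) * x' j \<beta>)) (at t0)"
  using C
proof induction
  case empty
  then show ?case by simp
next
  case (insert c C)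
  obtain j \<beta> where c: "c = (j, \<beta>)" by (cases c)
  define y where "y = (\<lambda>t i. \<chi> \<gamma>. if (i, \<gamma>) \<in> C then x t i $ \<gamma> else x t0 i $ \<gamma>)"
  define d where "d = (\<lambda>t. x t j $ \<beta> - x t0 j $ \<beta>)"
  define p where "p = pdiff j \<beta> f"
  define up where "up = (\<lambda>t s. (y t)(j := y t j + s *\<^sub>R axis \<beta> 1))"
  have up0: "up t 0 = y t" for t
    by (simp add: up_def)
  have y_insert: "(\<lambda>i. \<chi> \<gamma>. if (i, \<gamma>) \<in> insert c C then x t i $ \<gamma> else x t0 i $ \<gamma>) = up t (d t)" for t
    using insert.hyps(2) unfolding up_def y_def d_def c
    by (intro ext) (auto simp: vec_eq_iff axis_def)
  have tend_y: "((\<lambda>t. y t i) \<longlongrightarrow> x t0 i) (nhds t0)" for i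
    unfolding y_def by (rule tendsto_move_coordinates) (rule DERIV_isCont[OF x])
  \<comment> \<open>Uniformity in the intermediate point s comes from joint convergence in (t, s).\<close>
  have tend_up: "((\<lambda>(t, s). up t s) \<longlongrightarrow> x t0) (nhds t0 \<times>\<^sub>F nhds 0)"
    unfolding up_def case_prod_beta
  proof (rule tendsto_nudge)
    show "((\<lambda>ts. y (fst ts) i) \<longlongrightarrow> x t0 i) (nhds t0 \<times>\<^sub>F nhds 0)" for i
      by (rule filterlim_compose[OF tend_y filterlim_fst])
    have "((\<lambda>ts. snd ts *\<^sub>R axis \<beta> 1) \<longlongrightarrow> 0 *\<^sub>R axis \<beta> (1::real)) (nhds t0 \<times>\<^sub>F nhds (0::real))"
      by (intro tendsto_scaleR filterlim_snd tendsto_const)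
    then show "((\<lambda>ts. snd ts *\<^sub>R axis \<beta> 1) \<longlongrightarrow> (0::real ^ 'q)) (nhds t0 \<times>\<^sub>F nhds (0::real))"
      by simp
  qed
  have cont_p: "isCont p (x t0)"
    using f S unfolding p_def by (simp add: continuous_on_eq_continuous_at)
  have d_quot: "((\<lambda>t. d t / (t - t0)) \<longlongrightarrow> x' j \<beta>) (at t0)"
    using x[of j \<beta>] unfolding d_def has_field_derivative_iff .
  have d_lim: "(d \<longlongrightarrow> 0) (at t0)"
    unfolding d_def by (rule LIM_zero, rule isContD, rule DERIV_isCont, rule x)
  \<comment> \<open>The increment of f divided by the increment of the coordinate. The value at a zero increment
    is chosen so that the increment of f is the product of both in all cases.\<close>
  define r where "r = (\<lambda>t. if d t = 0 then p (x t0) else (f (up t (d t)) - f (y t)) / d t)"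
  have "(r \<longlongrightarrow> p (x t0)) (at t0)"
  proof (rule tendstoI)
    fix e :: real assume "e > 0"
    then have e2: "e / 2 > 0" by simp
    have "\<forall>\<^sub>F ts in nhds t0 \<times>\<^sub>F nhds 0. case_prod up ts \<in> S"
      using tend_up S by (rule topological_tendstoD)
    moreover have "\<forall>\<^sub>F ts in nhds t0 \<times>\<^sub>F nhds 0. dist (p (case_prod up ts)) (p (x t0)) < e / 2"
      using isCont_tendsto_compose[OF cont_p tend_up] e2 by (rule tendstoD)
    ultimately have "\<forall>\<^sub>F ts in nhds t0 \<times>\<^sub>F nhds 0.
        case_prod up ts \<in> S \<and> dist (p (case_prod up ts)) (p (x t0)) < e / 2"
      by (rule eventually_conj)
    then obtain P1 P2 where P: "eventually P1 (nhds t0)" "eventually P2 (nhds 0)"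
      and PP: "\<And>t s. P1 t \<Longrightarrow> P2 s \<Longrightarrow> up t s \<in> S \<and> dist (p (up t s)) (p (x t0)) < e / 2"
      unfolding eventually_prod_filter by auto
    obtain \<eta> where \<eta>: "\<eta> > 0" "\<And>s. dist s 0 < \<eta> \<Longrightarrow> P2 s"
      using P(2) unfolding eventually_nhds_metric by auto
    have "\<forall>\<^sub>F t in at t0. P1 t"
      using P(1) by (auto simp: eventually_at_filter elim: eventually_mono)
    moreover have "\<forall>\<^sub>F t in at t0. dist (d t) 0 < \<eta>"
      using d_lim \<eta>(1) by (rule tendstoD)
    ultimately show "\<forall>\<^sub>F t in at t0. dist (r t) (p (x t0)) < e"
    proof eventually_elim
      case (elim t)
      let ?F = "\<lambda>s. f (up t s) - p (x t0) * s"
      have near: "up t s \<in> S" "\<bar>p (up t s) - p (x t0)\<bar> \<le> e / 2" if "s \<in> ball 0 \<eta>" for s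
        using PP[OF elim(1) \<eta>(2), of s] that by (auto simp: dist_real_def)
      have "norm (?F (d t) - ?F 0) \<le> e / 2 * norm (d t - 0)"
      proof (rule field_differentiable_bound[where S = "ball 0 \<eta>" and f' = "\<lambda>s. p (up t s) - p (x t0)"])
        fix s :: real assume s: "s \<in> ball 0 \<eta>"
        have "((\<lambda>s. f (up t s)) has_real_derivative p (up t s)) (at s)"
          unfolding up_def p_def
          by (rule jet_has_derivative_partial[OF f]) (use near(1)[OF s] in \<open>simp add: up_def\<close>)
        then have "(?F has_real_derivative p (up t s) - p (x t0)) (at s)"
          by (auto intro!: derivative_eq_intros)
        then show "(?F has_real_derivative p (up t s) - p (x t0)) (at s within ball 0 \<eta>)"
          by (rule DERIV_subset) simp
        show "norm (p (up t s) - p (x t0)) \<le> e / 2"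
          using near(2)[OF s] by simp
      qed (use elim \<eta> in \<open>auto simp: dist_commute\<close>)
      then have bound: "\<bar>f (up t (d t)) - f (y t) - p (x t0) * d t\<bar> \<le> e / 2 * \<bar>d t\<bar>"
        by (simp add: up0 algebra_simps)
      show ?case
      proof (cases "d t = 0")
        case True
        then show ?thesis using \<open>e > 0\<close> by (simp add: r_def)
      next
        case False
        have "r t - p (x t0) = (f (up t (d t)) - f (y t) - p (x t0) * d t) / d t"
          using False by (simp add: r_def field_simps)
        then have "\<bar>r t - p (x t0)\<bar> \<le> e / 2"
          using bound False by (simp add: abs_divide divide_le_eq)
        then show ?thesis using \<open>e > 0\<close> by (simp add: dist_real_def)
      qed
    qed
  qed
  from tendsto_mult[OF this d_quot]
  have "((\<lambda>t. (f (up t (d t)) - f (y t)) / (t - t0)) \<longlongrightarrow> p (x t0) * x' j \<beta>) (at t0)"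
    by (rule Lim_transform_eventually) (auto intro!: always_eventually simp: r_def up0)
  moreover have "up t0 (d t0) = y t0"
    by (simp add: d_def up0)
  ultimately have "((\<lambda>t. f (up t (d t)) - f (y t)) has_real_derivative p (x t0) * x' j \<beta>) (at t0)"
    unfolding has_field_derivative_iff by simp
  moreover have "((\<lambda>t. f (y t)) has_real_derivative
      (\<Sum>(j, \<beta>)\<in>C. pdiff j \<beta> f (x t0) * x' j \<beta>)) (at t0)"
    using insert.IH unfolding y_def .
  ultimately have "((\<lambda>t. f (up t (d t)) - f (y t) + f (y t)) has_real_derivative
      p (x t0) * x' j \<beta> + (\<Sum>(j, \<beta>)\<in>C. pdiff j \<beta> f (x t0) * x' j \<beta>)) (at t0)"
    by (rule DERIV_add)
  then show ?case
    unfolding y_insert using insert.hyps by (simp add: c p_def)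
qed

text \<open>The finite window leaves finitely many coordinates that matter. The curve itself need not be
  confined to them, so it is compared with the curve whose entries outside the window are frozen;
  that curve lies in \<open>S\<close> near \<open>t0\<close>.\<close>

lemma jet_chain_rule:
  fixes f :: "(int \<Rightarrow> real ^ 'q::finite) \<Rightarrow> real" and x :: "real \<Rightarrow> int \<Rightarrow> real ^ 'q"
  assumes f: "jet_smooth S {a..b} f" and S: "open S" "\<And>t. x t \<in> S"
    and x: "\<And>j \<beta>. ((\<lambda>t. x t j $ \<beta>) has_real_derivative x' j \<beta>) (at t0)"
  shows "((\<lambda>t. f (x t)) has_real_derivative
           (\<Sum>j\<in>{a..b}. \<Sum>\<beta>\<in>UNIV. pdiff j \<beta> f (x t0) * x' j \<beta>)) (at t0)"
proof -
  let ?C = "{a..b} \<times> (UNIV :: 'q set)"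
  define y where "y = (\<lambda>t j. \<chi> \<beta>. if (j, \<beta>) \<in> ?C then x t j $ \<beta> else x t0 j $ \<beta>)"
  have "(y \<longlongrightarrow> x t0) (nhds t0)"
    unfolding y_def
    by (rule tendsto_coordinatewise, rule tendsto_move_coordinates) (rule DERIV_isCont[OF x])
  then have "\<forall>\<^sub>F t in nhds t0. y t \<in> S"
    using S by (intro topological_tendstoD)
  then have "\<forall>\<^sub>F t in nhds t0. f (y t) = f (x t)"
  proof eventually_elim
    case (elim t)
    have "y t j = x t j" if "j \<in> {a..b}" for j
      using that by (simp add: y_def vec_eq_iff)
    then show ?case
      using f S(2)[of t] elim unfolding jet_smooth_def depends_on_def by blast
  qed
  moreover have "((\<lambda>t. f (y t)) has_real_derivative
      (\<Sum>(j, \<beta>)\<in>?C. pdiff j \<beta> f (x t0) * x' j \<beta>)) (at t0)"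
    unfolding y_def
    by (rule jet_chain_rule_coordinates[OF _ S(1) S(2) _ x]) (use f in \<open>auto simp: jet_smooth_def\<close>)
  ultimately show ?thesis
    by (subst (asm) DERIV_cong_ev[OF refl _ refl]) (simp_all add: sum.cartesian_product)
qed

section \<open>Variations of a single entry\<close>

lemma eventually_nudge_open:
  fixes z :: "int \<Rightarrow> 'a::real_normed_vector"
  assumes "open S" "z \<in> S"
  shows "\<forall>\<^sub>F v in nhds 0. z(j := z j + v) \<in> S"
proof -
  have "((\<lambda>v. z(j := z j + v)) \<longlongrightarrow> z) (nhds 0)"
    by (rule tendsto_nudge) (auto intro: filterlim_ident)
  then show ?thesis
    using assms by (rule topological_tendstoD)
qed

lemma shift_shift [simp]: "shift j (shift k z) = shift (k + j) z"
  by (simp add: shift_def algebra_simps)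

lemma shift_0 [simp]: "shift 0 z = z"
  by (simp add: shift_def)

lemma shift_apply: "shift k z j = z (j + k)"
  by (simp add: shift_def)

lemma shift_update: "shift k (z(j := v)) = (shift k z)(j - k := v)"
  by (auto simp: shift_def fun_eq_iff)

lemma frame_domain_shift:
  assumes "z \<in> frame_domain \<Omega> n"
  shows "shift k z \<in> frame_domain \<Omega> (n + k)"
proof -
  have "shift (k + i) z \<in> \<Omega> (n + (k + i))" for i
    using assms unfolding frame_domain_def by blast
  then show ?thesis
    by (simp add: frame_domain_def add.assoc)
qed

text \<open>The frame domain imposes one open condition for each of infinitely many shifts, so it need not
  be open in the product topology. But a single entry occurs in only finitely many of these
  conditions, because the windows have bounded length.\<close>

lemma eventually_nudge_frame_domain:
  fixes z :: "int \<Rightarrow> 'a::real_normed_vector"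
  assumes op: "\<And>n. open (\<Omega> n)" and cyl: "\<And>n. cylinder {a..b} (\<Omega> n)" and z: "z \<in> frame_domain \<Omega> n"
  shows "\<forall>\<^sub>F v in nhds 0. z(j := z j + v) \<in> frame_domain \<Omega> n"
proof -
  have z': "shift k z \<in> \<Omega> (n + k)" for k
    using z by (simp add: frame_domain_def)
  have "\<forall>\<^sub>F v in nhds 0. \<forall>k\<in>{j - b..j - a}. shift k (z(j := z j + v)) \<in> \<Omega> (n + k)"
  proof (intro eventually_ball_finite ballI)
    show "\<forall>\<^sub>F v in nhds 0. shift k (z(j := z j + v)) \<in> \<Omega> (n + k)" for k
      using eventually_nudge_open[OF op z'[of k], of "j - k"] by (simp add: shift_update shift_apply)
  qed simp
  then show ?thesis
  proof eventually_elim
    case (elim v)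
    have "shift k (z(j := z j + v)) \<in> \<Omega> (n + k)" for k
    proof (cases "k \<in> {j - b..j - a}")
      case False
      then have "\<forall>i\<in>{a..b}. shift k (z(j := z j + v)) i = shift k z i"
        by (auto simp: shift_def)
      then show ?thesis
        using cyl z'[of k] unfolding cylinder_def by blast
    qed (use elim in blast)
    then show ?case
      by (simp add: frame_domain_def)
  qed
qed

text \<open>This family is closed under differentiation, which makes the induction on the order of
  differentiability work; with zero amplitude it contains the constant curves.\<close>

lemma Ck_on_sinusoid:
  fixes v :: "'a::real_normed_vector"
  shows "Ck_on k UNIV (\<lambda>t::real. w + (p * sin (c * t) + q * cos (c * t)) *\<^sub>R v)"
proof (induction k arbitrary: w p q)
  case 0
  show ?case
    by (auto intro!: continuous_intros)
next
  case (Suc k)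
  have deriv: "((\<lambda>t. w + (p * sin (c * t) + q * cos (c * t)) *\<^sub>R v) has_derivative
      (\<lambda>h. (h * (c * p * cos (c * t) - c * q * sin (c * t))) *\<^sub>R v)) (at t)" for t
    by (auto intro!: derivative_eq_intros simp: algebra_simps)
  then have "(\<lambda>t. frechet_derivative (\<lambda>t. w + (p * sin (c * t) + q * cos (c * t)) *\<^sub>R v) (at t) 1) =
      (\<lambda>t. 0 + ((- c * q) * sin (c * t) + (c * p) * cos (c * t)) *\<^sub>R v)"
    by (intro ext, subst frechet_derivative_at[OF deriv, symmetric]) (simp add: algebra_simps)
  then show ?case
    using Suc[of 0 "- c * q" "c * p"] deriv by (auto simp: differentiable_def simp del: add_0)
qed

text \<open>A variation has to stay in \<open>D n\<close> for all times, so a straight line will not do in general. A sine of small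
  amplitude stays within the room that \<open>z\<close> has in \<open>D n\<close>, and its frequency is the inverse of the
  amplitude, so that the initial speed is \<open>1\<close>.\<close>

lemma exists_test_variation:
  fixes z :: "int \<Rightarrow> real ^ 'q::finite"
  assumes "\<forall>\<^sub>F v in nhds 0. z(0 := z 0 + v) \<in> D n"
  obtains \<phi> where "\<phi> 0 = 0" "(\<phi> has_real_derivative 1) (at 0)"
    "variation D n (\<lambda>j t. (z(0 := z 0 + \<phi> t *\<^sub>R axis \<alpha> 1)) j)"
proof -
  obtain e where e: "e > 0" "\<And>v. norm v < e \<Longrightarrow> z(0 := z 0 + v) \<in> D n"
    using assms unfolding eventually_nhds_metric by auto
  define \<phi> where "\<phi> = (\<lambda>t. e / 2 * sin (2 / e * t))"
  show thesis
  proof (rule that)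
    show "\<phi> 0 = 0" by (simp add: \<phi>_def)
    show "(\<phi> has_real_derivative 1) (at 0)"
      unfolding \<phi>_def using e(1) by (auto intro!: derivative_eq_intros)
    have "smooth_on UNIV (\<lambda>t. (z(0 := z 0 + \<phi> t *\<^sub>R axis \<alpha> 1)) j)" for j
      using Ck_on_sinusoid[of _ "z 0" "e / 2" "2 / e" 0 "axis \<alpha> 1"] Ck_on_sinusoid[of _ "z j" 0 0 0 0]
      by (cases "j = 0") (simp_all add: smooth_on_def \<phi>_def)
    moreover have "at_time t (\<lambda>j t. (z(0 := z 0 + \<phi> t *\<^sub>R axis \<alpha> 1)) j) \<in> D n" for t
    proof -
      have "\<bar>sin (2 / e * t)\<bar> < 2"
        by (rule le_less_trans[OF abs_sin_le_one]) simp
      then have "norm (\<phi> t *\<^sub>R axis \<alpha> (1::real)) < e"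
        using e(1) by (simp add: \<phi>_def abs_mult)
      from e(2)[OF this] show ?thesis
        unfolding at_time_def .
    qed
    ultimately show "variation D n (\<lambda>j t. (z(0 := z 0 + \<phi> t *\<^sub>R axis \<alpha> 1)) j)"
      by (simp add: variation_def)
  qed
qed

lemma eventually_nudge_axis:
  fixes z :: "int \<Rightarrow> real ^ 'q::finite"
  assumes "\<forall>\<^sub>F v in nhds 0. z(j := z j + v) \<in> S"
  shows "\<forall>\<^sub>F s in nhds (0::real). z(j := z j + s *\<^sub>R axis \<alpha> 1) \<in> S"
proof -
  have "((\<lambda>s. s *\<^sub>R axis \<alpha> (1::real)) \<longlongrightarrow> 0 *\<^sub>R (axis \<alpha> 1 :: real ^ 'q)) (nhds 0)"
    by (intro tendsto_intros filterlim_ident)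
  then show ?thesis
    using assms by (auto simp: filterlim_iff)
qed

section \<open>Euler operators and summation over the base points\<close>

lemma pdiff_outside_window:
  fixes z :: "int \<Rightarrow> real ^ 'q::finite"
  assumes f: "depends_on S W f" and z: "z \<in> S" "\<forall>\<^sub>F v in nhds 0. z(j := z j + v) \<in> S" and j: "j \<notin> W"
  shows "pdiff j \<alpha> f z = 0"
proof -
  have "\<forall>\<^sub>F s in nhds 0. f (z(j := z j + s *\<^sub>R axis \<alpha> 1)) = f z"
    using eventually_nudge_axis[OF z(2), of \<alpha>]
  proof eventually_elim
    case (elim s)
    have "\<forall>i\<in>W. (z(j := z j + s *\<^sub>R axis \<alpha> 1)) i = z i"
      using j by auto
    then show ?case
      using f z(1) elim unfolding depends_on_def by blast
  qed
  then have "((\<lambda>s. f (z(j := z j + s *\<^sub>R axis \<alpha> 1))) has_real_derivative 0) (at 0)"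
    by (subst DERIV_cong_ev[OF refl _ refl]) auto
  then show ?thesis
    unfolding pdiff_def by (rule DERIV_imp_deriv)
qed

text \<open>Only the shifts of \<open>z\<close> itself need to lie in the domains. This covers both the Lagrangian in the
  original variables, whose domains are shift invariant, and the one in the invariants, whose
  domains \<open>Q n\<close> need not be.\<close>

lemma euler_eq_sum:
  assumes f: "smooth_fun D a b f" and z: "\<And>k. shift k z \<in> D (n + k)"
    and D: "\<And>m w j. w \<in> D m \<Longrightarrow> \<forall>\<^sub>F v in nhds 0. w(j := w j + v) \<in> D m"
  shows "euler \<alpha> f n z = (\<Sum>j\<in>{a..b}. pdiff j \<alpha> (f (n - j)) (shift (- j) z))"
proof -
  have "pdiff j \<alpha> (f (n - j)) (shift (- j) z) = 0" if "j \<notin> {a..b}" for j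
    using f z[of "- j"] D[OF z, of "- j" j] that
    by (intro pdiff_outside_window[of "D (n - j)" "{a..b}"]) (auto simp: smooth_fun_def jet_smooth_def)
  then have "{j. pdiff j \<alpha> (f (n - j)) (shift (- j) z) \<noteq> 0} \<subseteq> {a..b}"
    by blast
  then show ?thesis
    unfolding euler_def Sh_def by (subst Sum_any.expand_superset[of "{a..b}"]) simp_all
qed

lemma sum_telescope_int:
  fixes h :: "int \<Rightarrow> 'a::ab_group_add"
  assumes "a \<le> b"
  shows "(\<Sum>m\<in>{a..<b}. h (m + 1) - h m) = h b - h a"
  using assms
proof (induction b rule: int_ge_induct)
  case (step i)
  then have "{a..<i + 1} = insert i {a..<i}" by auto
  then show ?case using step by simp
qed simp

text \<open>Summation by parts in a window: since \<open>a\<close> vanishes outside \<open>{-B..B}\<close>, shifting the summation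
  index by at most \<open>b\<close> does not reach the ends \<open>-M\<close> and \<open>M\<close>, so no boundary terms appear.\<close>

lemma sum_convolution_reindex:
  fixes a :: "int \<Rightarrow> real"
  assumes a: "\<And>i. \<bar>i\<bar> > B \<Longrightarrow> a i = 0" and M: "B + b < M"  "0 \<le> B" "0 \<le> b"
  shows "(\<Sum>m\<in>{- M..<M}. \<Sum>j\<in>{0..b}. p j m * a (m + j)) =
         (\<Sum>i\<in>{- B..B}. (\<Sum>j\<in>{0..b}. p j (i - j)) * a i)"
proof -
  have "(\<Sum>m\<in>{- M..<M}. p j m * a (m + j)) = (\<Sum>i\<in>{- B..B}. p j (i - j) * a i)"
    if j: "j \<in> {0..b}" for j
  proof -
    have "(\<Sum>m\<in>{- M..<M}. p j m * a (m + j)) = (\<Sum>m\<in>{- B - j..B - j}. p j m * a (m + j))"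
    proof (rule sum.mono_neutral_right)
      show "\<forall>i\<in>{- M..<M} - {- B - j..B - j}. p j i * a (i + j) = 0"
        using a by auto
    qed (use j M in auto)
    also have "\<dots> = (\<Sum>i\<in>{- B..B}. p j (i - j) * a i)"
      by (rule sum.reindex_bij_witness[of _ "\<lambda>i. i - j" "\<lambda>m. m + j"]) auto
    finally show ?thesis .
  qed
  then show ?thesis
    by (subst sum.swap) (simp add: sum_distrib_right sum.swap[of _ "{- B..B}"])
qed

section \<open>The Euler operator in terms of the invariants\<close>

lemma \<kappa>_jet_shift: "\<kappa>_jet \<kappa> (n + k) (shift k z) = shift k (\<kappa>_jet \<kappa> n z)"
  by (rule ext) (simp add: \<kappa>_jet_def Sh_def shift_apply algebra_simps)

lemma at_time_shift: "at_time t (shift k \<zeta>) = shift k (at_time t \<zeta>)"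
  by (simp add: at_time_def shift_def)

lemma variation_shift:
  assumes "variation D n \<zeta>" and "\<And>n z k. z \<in> D n \<Longrightarrow> shift k z \<in> D (n + k)"
  shows "variation D (n + k) (shift k \<zeta>)"
  using assms unfolding variation_def by (simp add: at_time_shift shift_apply)

text \<open>All entries but \<open>\<zeta> 0\<close> are at rest, so the shift \<open>S\<^sub>j \<sigma>\<close> taken at base point \<open>n + i\<close> vanishes
  unless \<open>j = -i\<close>, and the operator \<open>H\<close> reduces to a single coefficient.\<close>

lemma syzygy_single_entry:
  assumes syz: "syzygies act D \<rho> \<kappa> H" and D: "\<And>n z k. z \<in> D n \<Longrightarrow> shift k z \<in> D (n + k)"
    and \<zeta>: "variation D n \<zeta>" and const: "\<And>j t. j \<noteq> 0 \<Longrightarrow> \<zeta> j t = \<zeta> j 0"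
  shows "((\<lambda>t. \<kappa>_jet \<kappa> n (at_time t \<zeta>) i $ \<beta>) has_real_derivative
           (\<Sum>\<gamma>\<in>UNIV. H \<beta> \<gamma> (- i) (n + i) (shift i (\<kappa>_jet \<kappa> n (at_time t0 \<zeta>))) * \<sigma>_inv act \<rho> t0 \<gamma> n \<zeta>)) (at t0)"
proof -
  have \<sigma>: "\<sigma>_inv act \<rho> t0 \<gamma> m (shift l \<zeta>) = 0" if "l \<noteq> 0" for \<gamma> m l
  proof -
    have "shift l \<zeta> 0 s = \<zeta> l 0" for s
      using const[OF that, of s] by (simp add: shift_apply)
    then show ?thesis
      by (simp add: \<sigma>_inv_def)
  qed
  have "app_op (\<lambda>j m \<xi>. in_terms_of \<kappa> (H \<beta> \<gamma> j) m (at_time t0 \<xi>)) (\<sigma>_inv act \<rho> t0 \<gamma>) (n + i) (shift i \<zeta>) =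
      H \<beta> \<gamma> (- i) (n + i) (shift i (\<kappa>_jet \<kappa> n (at_time t0 \<zeta>))) * \<sigma>_inv act \<rho> t0 \<gamma> n \<zeta>" for \<gamma>
  proof -
    let ?s = "\<lambda>j. H \<beta> \<gamma> j (n + i) (shift i (\<kappa>_jet \<kappa> n (at_time t0 \<zeta>))) *
      \<sigma>_inv act \<rho> t0 \<gamma> (n + i + j) (shift (i + j) \<zeta>)"
    have "?s j = 0" if "j \<noteq> - i" for j
      using \<sigma>[of "i + j" \<gamma> "n + i + j"] that by simp
    then have "{j. ?s j \<noteq> 0} \<subseteq> {- i}"
      by blast
    then have "Sum_any ?s = ?s (- i)"
      by (subst Sum_any.expand_superset[of "{- i}"]) simp_all
    then show ?thesis
      by (simp add: app_op_def Sh_def in_terms_of_def at_time_shift \<kappa>_jet_shift)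
  qed
  moreover have "((\<lambda>t. \<kappa> \<beta> (n + i) (at_time t (shift i \<zeta>))) has_real_derivative
      app_matrix (\<lambda>\<beta> \<alpha> j m \<xi>. in_terms_of \<kappa> (H \<beta> \<alpha> j) m (at_time t0 \<xi>)) (\<sigma>_inv act \<rho> t0) \<beta>
        (n + i) (shift i \<zeta>)) (at t0)"
    using syz variation_shift[OF \<zeta> D] unfolding syzygies_def by blast
  ultimately show ?thesis
    by (simp add: app_matrix_def at_time_shift \<kappa>_jet_def Sh_def)
qed

text \<open>The core of the argument: the Euler operator is computed along a variation that moves one
  component of the entry \<open>0\<close> with unit speed, once from the original Lagrangian and once from its
  form in the invariants.\<close>

lemma euler_via_invariants:
  fixes z :: "int \<Rightarrow> real ^ 'q::finite" and L :: "int \<Rightarrow> (int \<Rightarrow> real ^ 'p::finite) \<Rightarrow> real"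
  assumes D_shift: "\<And>n z k. z \<in> D n \<Longrightarrow> shift k z \<in> D (n + k)"
    and D_nudge: "\<And>n z j. z \<in> D n \<Longrightarrow> \<forall>\<^sub>F v in nhds 0. z(j := z j + v) \<in> D n"
    and LL: "smooth_fun D 0 (int JL) LL"
    and Q: "\<And>n. open (Q n)" "\<And>n z. z \<in> D n \<Longrightarrow> \<kappa>_jet \<kappa> n z \<in> Q n"
    and L: "smooth_fun Q 0 (int J1) L"
    and same: "same_functional D LL (in_terms_of \<kappa> L)"
    and H: "\<And>\<beta> \<alpha>. difference_op Q (H \<beta> \<alpha>)"
    and syz: "syzygies act D \<rho> \<kappa> H"
    and z: "z \<in> D n" and \<phi>: "\<phi> 0 = 0" "(\<phi> has_real_derivative 1) (at 0)"
    and \<zeta>_def: "\<zeta> = (\<lambda>j t. (z(0 := z 0 + \<phi> t *\<^sub>R axis \<alpha> 1)) j)" and \<zeta>: "variation D n \<zeta>"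
  shows "euler \<alpha> LL n z =
           (\<Sum>\<gamma>\<in>UNIV. in_terms_of \<kappa> (app_matrix_adjoint H (\<lambda>\<beta>. euler \<beta> L) \<gamma>) n z * \<sigma>_inv act \<rho> 0 \<gamma> n \<zeta>)"
proof -
  define k where "k = \<kappa>_jet \<kappa> n z"
  define \<sigma> where "\<sigma> = (\<lambda>\<gamma>. \<sigma>_inv act \<rho> 0 \<gamma> n \<zeta>)"
  define zt where "zt = (\<lambda>t. at_time t \<zeta>)"
  define kt where "kt = (\<lambda>t. \<kappa>_jet \<kappa> n (zt t))"
  define a where "a = (\<lambda>i \<beta>. \<Sum>\<gamma>\<in>UNIV. H \<beta> \<gamma> (- i) (n + i) (shift i k) * \<sigma> \<gamma>)"
  have zt: "zt t = z(0 := z 0 + \<phi> t *\<^sub>R axis \<alpha> 1)" for t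
    unfolding zt_def at_time_def \<zeta>_def ..
  have zt_D: "shift m (zt t) \<in> D (n + m)" for m t
    using \<zeta> D_shift by (simp add: variation_def zt_def)
  have zt0: "zt 0 = z"
    by (simp add: zt \<phi>(1))
  have kt0: "kt 0 = k"
    by (simp add: kt_def k_def zt0)
  have kt_Q: "shift m (kt t) \<in> Q (n + m)" for m t
    using Q(2)[OF zt_D[of m t]] by (simp add: \<kappa>_jet_shift kt_def)
  have k_Q: "shift m k \<in> Q (n + m)" for m
    using kt_Q[of m 0] by (simp add: kt0)
  have z_D: "shift m z \<in> D (n + m)" for m
    using zt_D[of m 0] by (simp add: zt0)

  have kt_deriv: "((\<lambda>t. kt t i $ \<beta>) has_real_derivative a i \<beta>) (at 0)" for i \<beta>
  proof -
    have const: "\<zeta> j t = \<zeta> j 0" if "j \<noteq> 0" for j t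
      using that by (simp add: \<zeta>_def)
    show ?thesis
      unfolding kt_def a_def k_def \<sigma>_def zt0[symmetric] unfolding zt_def
      by (rule syzygy_single_entry[OF syz D_shift \<zeta> const])
  qed

  \<comment> \<open>B bounds the orders of all operators in H. Hence only the invariants shifted by
    at most B have a velocity.\<close>
  define T where "T = (\<Union>(\<beta>, \<gamma>)\<in>UNIV. {j. H \<beta> \<gamma> j \<noteq> (\<lambda>n z. 0)})"
  define B where "B = Max (insert 0 (abs ` T))"
  have "finite T"
    using H by (auto simp: difference_op_def T_def)
  then have "0 \<le> B" "\<And>j. j \<in> T \<Longrightarrow> \<bar>j\<bar> \<le> B"
    by (auto simp: B_def)
  then have B: "0 \<le> B" "\<And>j \<beta> \<gamma>. \<bar>j\<bar> > B \<Longrightarrow> H \<beta> \<gamma> j = (\<lambda>n z. 0)"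
    unfolding T_def by fastforce+
  have a_0: "a i \<beta> = 0" if "\<bar>i\<bar> > B" for i \<beta>
    using B(2)[of "- i"] that by (simp add: a_def)

  obtain F c d where F: "smooth_fun D c d F"
    and LL_F: "\<And>n z. z \<in> D n \<Longrightarrow> LL n z = in_terms_of \<kappa> L n z + (Sh 1 F n z - F n z)"
    using same unfolding same_functional_def difference_fun_def by blast
  \<comment> \<open>Large enough for the boundary terms of the total difference not to contain the moving entry,
    and for the sum to contain every base point at which either Lagrangian notices it.\<close>
  define M where "M = 1 + B + int J1 + int JL + \<bar>c\<bar> + \<bar>d\<bar>"

  have LL_deriv: "((\<lambda>t. LL (n + m) (shift m (zt t))) has_real_derivative
      pdiff (- m) \<alpha> (LL (n + m)) (shift m z)) (at 0)" for m
  proof -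
    let ?w = "shift m z"
    have "jet_Ck (Suc 0) (D (n + m)) (LL (n + m))"
      using LL unfolding smooth_fun_def jet_smooth_def by blast
    then have "((\<lambda>s. LL (n + m) (?w(- m := ?w (- m) + s *\<^sub>R axis \<alpha> 1))) has_real_derivative
        pdiff (- m) \<alpha> (LL (n + m)) (?w(- m := ?w (- m) + \<phi> 0 *\<^sub>R axis \<alpha> 1))) (at (\<phi> 0))"
      by (rule jet_has_derivative_partial) (use z_D \<phi>(1) in simp)
    from DERIV_chain'[OF \<phi>(2) this] show ?thesis
      by (simp add: zt shift_update shift_apply \<phi>(1) fun_upd_idem)
  qed
  have L_deriv: "((\<lambda>t. L (n + m) (shift m (kt t))) has_real_derivative
      (\<Sum>j\<in>{0..int J1}. \<Sum>\<beta>\<in>UNIV. pdiff j \<beta> (L (n + m)) (shift m k) * a (m + j) \<beta>)) (at 0)" for m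
  proof -
    have "jet_smooth (Q (n + m)) {0..int J1} (L (n + m))"
      using L by (simp add: smooth_fun_def)
    from jet_chain_rule[OF this Q(1), of "\<lambda>t. shift m (kt t)" "\<lambda>j \<beta>. a (m + j) \<beta>" 0]
    show ?thesis
      using kt_Q kt_deriv by (simp add: kt0 shift_apply add.commute)
  qed

  have F_const: "F (n + m) (shift m (zt t)) = F (n + m) (shift m z)" if "\<bar>m\<bar> = M" for m t
  proof -
    have "\<forall>j\<in>{c..d}. shift m (zt t) j = shift m z j"
      using that B(1) by (auto simp: M_def shift_apply zt)
    then show ?thesis
      using F zt_D z_D unfolding smooth_fun_def jet_smooth_def depends_on_def by blast
  qed
  have M: "0 \<le> M"
    using B(1) by (simp add: M_def)
  have "(\<Sum>m\<in>{- M..<M}. LL (n + m) (shift m (zt t))) =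
      (\<Sum>m\<in>{- M..<M}. L (n + m) (shift m (kt t))) + (F (n + M) (shift M z) - F (n - M) (shift (- M) z))" for t
  proof -
    have "LL (n + m) (shift m (zt t)) = L (n + m) (shift m (kt t)) +
        (F (n + (m + 1)) (shift (m + 1) (zt t)) - F (n + m) (shift m (zt t)))" for m
      using LL_F[OF zt_D, of m t] by (simp add: in_terms_of_def \<kappa>_jet_shift kt_def Sh_def add.assoc)
    then have "(\<Sum>m\<in>{- M..<M}. LL (n + m) (shift m (zt t))) =
        (\<Sum>m\<in>{- M..<M}. L (n + m) (shift m (kt t))) +
        (\<Sum>m\<in>{- M..<M}. F (n + (m + 1)) (shift (m + 1) (zt t)) - F (n + m) (shift m (zt t)))"
      by (simp add: sum.distrib)
    also have "(\<Sum>m\<in>{- M..<M}. F (n + (m + 1)) (shift (m + 1) (zt t)) - F (n + m) (shift m (zt t))) =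
        F (n + M) (shift M (zt t)) - F (n + - M) (shift (- M) (zt t))"
      by (rule sum_telescope_int) (use M in simp)
    finally show ?thesis
      using F_const[of M t] F_const[of "- M" t] M by simp
  qed
  moreover have "((\<lambda>t. (\<Sum>m\<in>{- M..<M}. L (n + m) (shift m (kt t))) +
        (F (n + M) (shift M z) - F (n - M) (shift (- M) z))) has_real_derivative
      (\<Sum>m\<in>{- M..<M}. \<Sum>j\<in>{0..int J1}. \<Sum>\<beta>\<in>UNIV. pdiff j \<beta> (L (n + m)) (shift m k) * a (m + j) \<beta>) + 0) (at 0)"
    by (intro DERIV_add DERIV_sum L_deriv DERIV_const)
  moreover have "((\<lambda>t. \<Sum>m\<in>{- M..<M}. LL (n + m) (shift m (zt t))) has_real_derivative
      (\<Sum>m\<in>{- M..<M}. pdiff (- m) \<alpha> (LL (n + m)) (shift m z))) (at 0)"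
    by (intro DERIV_sum LL_deriv)
  \<comment> \<open>Both sums differ by a constant in t, so their derivatives agree.\<close>
  ultimately have balance: "(\<Sum>m\<in>{- M..<M}. pdiff (- m) \<alpha> (LL (n + m)) (shift m z)) =
      (\<Sum>m\<in>{- M..<M}. \<Sum>j\<in>{0..int J1}. \<Sum>\<beta>\<in>UNIV. pdiff j \<beta> (L (n + m)) (shift m k) * a (m + j) \<beta>)"
    using DERIV_unique by simp

  have "pdiff (- m) \<alpha> (LL (n + m)) (shift m z) = 0" if "- m \<notin> {0..int JL}" for m
    using LL that
    by (intro pdiff_outside_window[OF _ z_D D_nudge[OF z_D]]) (auto simp: smooth_fun_def jet_smooth_def)
  then have "(\<Sum>m\<in>{- M..<M}. pdiff (- m) \<alpha> (LL (n + m)) (shift m z)) =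
      (\<Sum>m\<in>{- int JL..0}. pdiff (- m) \<alpha> (LL (n + m)) (shift m z))"
    using B(1) by (intro sum.mono_neutral_right) (auto simp: M_def)
  also have "\<dots> = (\<Sum>j\<in>{0..int JL}. pdiff j \<alpha> (LL (n - j)) (shift (- j) z))"
    by (rule sum.reindex_bij_witness[of _ uminus uminus]) auto
  also have "\<dots> = euler \<alpha> LL n z"
    using euler_eq_sum[OF LL z_D D_nudge] by simp
  finally have lhs: "(\<Sum>m\<in>{- M..<M}. pdiff (- m) \<alpha> (LL (n + m)) (shift m z)) = euler \<alpha> LL n z" .

  have euler_L: "euler \<beta> L (n + i) (shift i k) =
      (\<Sum>j\<in>{0..int J1}. pdiff j \<beta> (L (n + (i - j))) (shift (i - j) k))" for \<beta> i
  proof -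
    have "shift j (shift i k) \<in> Q (n + i + j)" for j
      using k_Q[of "i + j"] by (simp add: add.assoc)
    from euler_eq_sum[OF L this eventually_nudge_open[OF Q(1)]] show ?thesis
      by (simp add: algebra_simps)
  qed
  have "(\<Sum>m\<in>{- M..<M}. \<Sum>j\<in>{0..int J1}. \<Sum>\<beta>\<in>UNIV. pdiff j \<beta> (L (n + m)) (shift m k) * a (m + j) \<beta>) =
      (\<Sum>\<beta>\<in>UNIV. \<Sum>m\<in>{- M..<M}. \<Sum>j\<in>{0..int J1}. pdiff j \<beta> (L (n + m)) (shift m k) * a (m + j) \<beta>)"
    by (simp only: sum.swap[of _ _ UNIV])
  also have "\<dots> = (\<Sum>\<beta>\<in>UNIV. \<Sum>i\<in>{- B..B}. euler \<beta> L (n + i) (shift i k) * a i \<beta>)"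
  proof (rule sum.cong[OF refl])
    fix \<beta>
    show "(\<Sum>m\<in>{- M..<M}. \<Sum>j\<in>{0..int J1}. pdiff j \<beta> (L (n + m)) (shift m k) * a (m + j) \<beta>) =
        (\<Sum>i\<in>{- B..B}. euler \<beta> L (n + i) (shift i k) * a i \<beta>)"
      unfolding euler_L
      by (rule sum_convolution_reindex[where p = "\<lambda>j m. pdiff j \<beta> (L (n + m)) (shift m k)"])
        (use a_0 B(1) in \<open>auto simp: M_def\<close>)
  qed
  also have "\<dots> = (\<Sum>\<gamma>\<in>UNIV. app_matrix_adjoint H (\<lambda>\<beta>. euler \<beta> L) \<gamma> n k * \<sigma> \<gamma>)"
  proof -
    have adj: "app_adjoint (H \<beta> \<gamma>) (euler \<beta> L) n k =
        (\<Sum>i\<in>{- B..B}. H \<beta> \<gamma> (- i) (n + i) (shift i k) * euler \<beta> L (n + i) (shift i k))" for \<beta> \<gamma>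
    proof -
      have "{j. H \<beta> \<gamma> j (n + - j) (shift (- j) k) * euler \<beta> L (n + - j) (shift (- j) k) \<noteq> 0} \<subseteq> {- B..B}"
        using B(2)[of _ \<beta> \<gamma>] by (force simp: not_less[symmetric] abs_le_iff)
      then have "app_adjoint (H \<beta> \<gamma>) (euler \<beta> L) n k =
          (\<Sum>j\<in>{- B..B}. H \<beta> \<gamma> j (n + - j) (shift (- j) k) * euler \<beta> L (n + - j) (shift (- j) k))"
        unfolding app_adjoint_def Sh_def by (rule Sum_any.expand_superset[rotated]) simp
      also have "\<dots> = (\<Sum>i\<in>{- B..B}. H \<beta> \<gamma> (- i) (n + i) (shift i k) * euler \<beta> L (n + i) (shift i k))"
        by (rule sum.reindex_bij_witness[of _ uminus uminus]) auto
      finally show ?thesis .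
    qed
    have "(\<Sum>\<beta>\<in>UNIV. \<Sum>i\<in>{- B..B}. euler \<beta> L (n + i) (shift i k) * a i \<beta>) =
        (\<Sum>\<beta>\<in>UNIV. \<Sum>i\<in>{- B..B}. \<Sum>\<gamma>\<in>UNIV.
          H \<beta> \<gamma> (- i) (n + i) (shift i k) * euler \<beta> L (n + i) (shift i k) * \<sigma> \<gamma>)"
      by (simp add: a_def sum_distrib_left mult_ac)
    also have "\<dots> = (\<Sum>\<gamma>\<in>UNIV. \<Sum>\<beta>\<in>UNIV. \<Sum>i\<in>{- B..B}.
          H \<beta> \<gamma> (- i) (n + i) (shift i k) * euler \<beta> L (n + i) (shift i k) * \<sigma> \<gamma>)"
      by (subst sum.swap[of _ UNIV UNIV]) (intro sum.cong refl sum.swap)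
    finally show ?thesis
      by (simp add: app_matrix_adjoint_def adj sum_distrib_right)
  qed
  finally show ?thesis
    using balance lhs by (simp add: in_terms_of_def k_def \<sigma>_def)
qed

section \<open>The group action on the frame domain\<close>

text \<open>Smoothness of the action is expressed in charts of the group; freezing the chart coordinates of
  the group element leaves a differentiable map of the point.\<close>

lemma smooth_action_differentiable:
  assumes "lie_group G X A" "smooth_action G A U act" "g \<in> carrier G" "u \<in> U"
  shows "act g differentiable (at u)"
proof -
  have "smooth_manifold X A" "topspace X = carrier G"
    using assms(1) by (auto simp: lie_group_def)
  then obtain V \<phi> where chart: "(V, \<phi>) \<in> A" "g \<in> V" "openin X V"
    "homeomorphic_map (subtopology X V) (top_of_set (\<phi> ` V)) \<phi>"
    using assms(3) unfolding smooth_manifold_def by blast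
  have "topspace (subtopology X V) = V"
    using openin_subset[OF chart(3)] by auto
  then have "inj_on \<phi> V"
    using homeomorphic_imp_injective_map[OF chart(4)] by simp
  then have inv: "the_inv_into V \<phi> (\<phi> g) = g"
    using chart(2) by (rule the_inv_into_f_f)
  have "smooth_on (\<phi> ` V \<times> U) (\<lambda>(y, u). act (the_inv_into V \<phi> y) u)"
    using assms(2) chart(1) by (auto simp: smooth_action_def)
  then have "Ck_on (Suc 0) (\<phi> ` V \<times> U) (\<lambda>(y, u). act (the_inv_into V \<phi> y) u)"
    unfolding smooth_on_def by blast
  then have "(\<lambda>(y, u). act (the_inv_into V \<phi> y) u) differentiable (at (\<phi> g, u))"
    using chart(2) assms(4) by auto
  moreover have "(\<lambda>u. (\<phi> g, u)) differentiable (at u)"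
    unfolding differentiable_def
    by (rule exI, rule has_derivative_Pair[OF has_derivative_const has_derivative_ident])
  ultimately have "((\<lambda>(y, u). act (the_inv_into V \<phi> y) u) \<circ> (\<lambda>u. (\<phi> g, u))) differentiable (at u)"
    by (intro differentiable_chain_at)
  then show ?thesis
    by (simp add: o_def inv)
qed

lemma diag_frame_domain:
  assumes "invariant_domain G U act J0 J \<Omega>" "z \<in> frame_domain \<Omega> n" "g \<in> carrier G"
  shows "diag act g z \<in> frame_domain \<Omega> n"
proof -
  have "diag act g (shift k z) \<in> \<Omega> (n + k)" for k
    using assms unfolding invariant_domain_def frame_domain_def by blast
  then show ?thesis
    by (simp add: frame_domain_def diag_def shift_def)
qed

lemma frame_domain_subset:
  assumes "invariant_domain G U act J0 J \<Omega>" "z \<in> frame_domain \<Omega> n"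
  shows "z \<in> \<Omega> n" "z 0 \<in> U"
proof -
  have "shift 0 z \<in> \<Omega> (n + 0)"
    using assms(2) unfolding frame_domain_def by blast
  then show "z \<in> \<Omega> n" by simp
  with assms(1) show "z 0 \<in> U"
    unfolding invariant_domain_def by force
qed

lemma \<kappa>_jet_invariant:
  assumes "\<And>\<beta>. invariant_fun G act D (\<kappa> \<beta>)" "\<And>k. shift k z \<in> D (n + k)" "g \<in> carrier G"
  shows "\<kappa>_jet \<kappa> n (diag act g z) = \<kappa>_jet \<kappa> n z"
proof -
  have "shift j (diag act g z) = diag act g (shift j z)" for j
    by (simp add: diag_def shift_def)
  then show ?thesis
    using assms by (simp add: \<kappa>_jet_def Sh_def invariant_fun_def)
qed

section \<open>Invariantized Euler-Lagrange equations\<close>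

theorem theorem5p2:
  fixes G :: "('g, 'm) monoid_scheme"
    and X :: "'g topology"
    and A :: "('g, 'r::finite) chart set"
    and U :: "(real ^ 'q::finite) set"
    and act :: "'g \<Rightarrow> real ^ 'q \<Rightarrow> real ^ 'q"
    and J0 J :: int
    and \<Omega> K D :: "int \<Rightarrow> (int \<Rightarrow> real ^ 'q) set"
    and \<rho> :: "int \<Rightarrow> (int \<Rightarrow> real ^ 'q) \<Rightarrow> 'g"
    and \<kappa> :: "'p::finite \<Rightarrow> int \<Rightarrow> (int \<Rightarrow> real ^ 'q) \<Rightarrow> real"
    and LL :: "int \<Rightarrow> (int \<Rightarrow> real ^ 'q) \<Rightarrow> real"
    and L :: "int \<Rightarrow> (int \<Rightarrow> real ^ 'p) \<Rightarrow> real"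
    and Q :: "int \<Rightarrow> (int \<Rightarrow> real ^ 'p) set"
    and H :: "'p \<Rightarrow> 'q \<Rightarrow> (real ^ 'p) dop"
    and JL J1 :: nat
  assumes "lie_group G X A"
    and "smooth_action G A U act"
    and "invariant_domain G U act J0 J \<Omega>"
    and "\<And>n. free_on G act {J0..J} (\<Omega> n)"
    and "\<And>n. regular_on G act {J0..J} (\<Omega> n)"
    and "right_moving_frame G X A act J0 J \<Omega> K \<rho>"
    and "D = frame_domain \<Omega>"
    and "smooth_fun D 0 (int JL) LL"
    and "invariant_fun G act D LL"
    and "generating_invariants G act D \<kappa>"
    and "\<And>n. open (Q n)" and "\<And>n z. z \<in> D n \<Longrightarrow> \<kappa>_jet \<kappa> n z \<in> Q n"
    and "smooth_fun Q 0 (int J1) L"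
    and "same_functional D LL (in_terms_of \<kappa> L)"
    and "\<And>\<beta> \<alpha>. difference_op Q (H \<beta> \<alpha>)"
    and "syzygies act D \<rho> \<kappa> H"
  shows "(\<forall>n \<zeta> t. variation D n \<zeta> \<longrightarrow>
           (\<Sum>\<alpha>\<in>UNIV. euler \<alpha> LL n (at_time t \<zeta>) * vector_derivative (\<zeta> 0) (at t) $ \<alpha>) =
           (\<Sum>\<alpha>\<in>UNIV. in_terms_of \<kappa> (app_matrix_adjoint H (\<lambda>\<beta>. euler \<beta> L) \<alpha>) n (at_time t \<zeta>)
                       * \<sigma>_inv act \<rho> t \<alpha> n \<zeta>)) \<and>
         (\<forall>n. \<forall>z\<in>D n. \<forall>\<alpha>.
           invariantize act \<rho> (euler \<alpha> LL) n z =
           in_terms_of \<kappa> (app_matrix_adjoint H (\<lambda>\<beta>. euler \<beta> L) \<alpha>) n z)"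
proof -
  note inv_dom = assms(3)
  have \<Omega>: "\<And>n. open (\<Omega> n)" "\<And>n. cylinder {J0..J} (\<Omega> n)"
    using inv_dom by (auto simp: invariant_domain_def)
  have D_shift: "\<And>n z k. z \<in> D n \<Longrightarrow> shift k z \<in> D (n + k)"
    unfolding assms(7) by (rule frame_domain_shift)
  have D_nudge: "\<And>n z j. z \<in> D n \<Longrightarrow> \<forall>\<^sub>F v in nhds 0. z(j := z j + v) \<in> D n"
    unfolding assms(7) by (rule eventually_nudge_frame_domain[OF \<Omega>])
  have in_U: "z 0 \<in> U" if "z \<in> D n" for z n
    using frame_domain_subset[OF inv_dom] that by (simp add: assms(7))
  have frame: "\<rho> n z \<in> carrier G" "g \<in> carrier G \<Longrightarrow> \<rho> n (diag act g z) = \<rho> n z \<otimes>\<^bsub>G\<^esub> inv\<^bsub>G\<^esub> g"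
    if "z \<in> D n" for z n g
    using assms(6) frame_domain_subset(1)[OF inv_dom] that by (auto simp: right_moving_frame_def assms(7))
  define R where "R = (\<lambda>\<gamma> n z. in_terms_of \<kappa> (app_matrix_adjoint H (\<lambda>\<beta>. euler \<beta> L) \<gamma>) n z)"

  have test: "\<exists>\<phi>. (\<phi> has_real_derivative 1) (at 0) \<and> \<phi> 0 = 0 \<and>
      (\<forall>s. z(0 := z 0 + \<phi> s *\<^sub>R axis \<alpha> 1) \<in> D n) \<and>
      euler \<alpha> LL n z = (\<Sum>\<gamma>\<in>UNIV. R \<gamma> n z *
        vector_derivative (\<lambda>s. act (\<rho> n z) (z 0 + \<phi> s *\<^sub>R axis \<alpha> 1)) (at 0) $ \<gamma>)"
    if z: "z \<in> D n" for z n \<alpha>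
  proof -
    obtain \<phi> where \<phi>: "\<phi> 0 = 0" "(\<phi> has_real_derivative 1) (at 0)"
      and \<zeta>: "variation D n (\<lambda>j t. (z(0 := z 0 + \<phi> t *\<^sub>R axis \<alpha> 1)) j)" (is "variation D n ?\<zeta>")
      using exists_test_variation[of z D n, OF D_nudge[OF z]] .
    have time: "at_time s ?\<zeta> = z(0 := z 0 + \<phi> s *\<^sub>R axis \<alpha> 1)" for s
      unfolding at_time_def ..
    have "at_time s ?\<zeta> \<in> D n" for s
      using \<zeta> unfolding variation_def by blast
    then have "\<forall>s. z(0 := z 0 + \<phi> s *\<^sub>R axis \<alpha> 1) \<in> D n"
      unfolding time by blast
    moreover have "euler \<alpha> LL n z = (\<Sum>\<gamma>\<in>UNIV. R \<gamma> n z * \<sigma>_inv act \<rho> 0 \<gamma> n ?\<zeta>)"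
      unfolding R_def
      by (rule euler_via_invariants[OF D_shift D_nudge assms(8,11,12,13,14,15,16) z \<phi> refl \<zeta>])
    ultimately show ?thesis
      using \<phi> unfolding \<sigma>_inv_def time by auto
  qed

  have "(\<Sum>\<alpha>\<in>UNIV. euler \<alpha> LL n (at_time t \<zeta>) * vector_derivative (\<zeta> 0) (at t) $ \<alpha>) =
      (\<Sum>\<gamma>\<in>UNIV. R \<gamma> n (at_time t \<zeta>) * \<sigma>_inv act \<rho> t \<gamma> n \<zeta>)"
    if \<zeta>: "variation D n \<zeta>" for n \<zeta> t
  proof -
    define z where "z = at_time t \<zeta>"
    define g where "g = \<rho> n z"
    define v where "v = vector_derivative (\<zeta> 0) (at t)"
    have z: "z \<in> D n"
      using \<zeta> by (simp add: variation_def z_def)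
    have z0: "z 0 = \<zeta> 0 t"
      by (simp add: z_def at_time_def)
    have "act g differentiable (at (z 0))"
      unfolding g_def by (rule smooth_action_differentiable[OF assms(1,2) frame(1) in_U]) (rule z)+
    then obtain T where T: "(act g has_derivative T) (at (z 0))"
      unfolding differentiable_def by blast
    then have "linear T"
      by (rule has_derivative_linear)
    \<comment> \<open>The derivative T of the action of the frozen frame element carries velocities to \<sigma>.\<close>
    have push: "vector_derivative (\<lambda>s. act g (c s)) (at s0) = T c'"
      if "(c has_vector_derivative c') (at s0)" "c s0 = z 0" for c c' s0
    proof (rule vector_derivative_at)
      have "((\<lambda>s. act g (c s)) has_derivative (\<lambda>h. T (h *\<^sub>R c'))) (at s0)"
        using has_derivative_compose[OF that(1)[unfolded has_vector_derivative_def], of "act g" T] T that(2)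
        by simp
      then show "((\<lambda>s. act g (c s)) has_vector_derivative T c') (at s0)"
        by (simp add: has_vector_derivative_def linear_scale[OF \<open>linear T\<close>])
    qed
    have "Ck_on (Suc 0) UNIV (\<zeta> 0)"
      using \<zeta> unfolding variation_def smooth_on_def by blast
    then have "(\<zeta> 0 has_vector_derivative v) (at t)"
      unfolding v_def by (simp add: vector_derivative_works[symmetric])
    from push[OF this z0[symmetric]] have \<sigma>: "\<sigma>_inv act \<rho> t \<gamma> n \<zeta> = T v $ \<gamma>" for \<gamma>
      by (simp add: \<sigma>_inv_def g_def z_def)
    have "euler \<alpha> LL n z = (\<Sum>\<gamma>\<in>UNIV. R \<gamma> n z * T (axis \<alpha> 1) $ \<gamma>)" for \<alpha>
    proof -
      obtain \<phi> where \<phi>: "(\<phi> has_real_derivative 1) (at 0)" "\<phi> 0 = 0"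
        and e: "euler \<alpha> LL n z = (\<Sum>\<gamma>\<in>UNIV. R \<gamma> n z *
          vector_derivative (\<lambda>s. act g (z 0 + \<phi> s *\<^sub>R axis \<alpha> 1)) (at 0) $ \<gamma>)"
        using test[OF z] unfolding g_def by blast
      have "((\<lambda>s. z 0 + \<phi> s *\<^sub>R axis \<alpha> 1) has_vector_derivative axis \<alpha> 1) (at 0)"
        using \<phi>(1) by (auto intro!: derivative_eq_intros simp: has_real_derivative_iff_has_vector_derivative)
      from push[OF this] show ?thesis
        unfolding e by (simp add: \<phi>(2))
    qed
    then have "(\<Sum>\<alpha>\<in>UNIV. euler \<alpha> LL n z * v $ \<alpha>) =
        (\<Sum>\<alpha>\<in>UNIV. \<Sum>\<gamma>\<in>UNIV. R \<gamma> n z * (v $ \<alpha> *\<^sub>R T (axis \<alpha> 1)) $ \<gamma>)"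
      by (simp add: sum_distrib_left mult_ac)
    also have "\<dots> = (\<Sum>\<gamma>\<in>UNIV. R \<gamma> n z * (\<Sum>\<alpha>\<in>UNIV. v $ \<alpha> *\<^sub>R T (axis \<alpha> 1)) $ \<gamma>)"
      by (subst sum.swap) (simp add: sum_distrib_left)
    also have "(\<Sum>\<alpha>\<in>UNIV. v $ \<alpha> *\<^sub>R T (axis \<alpha> 1)) = T (\<Sum>\<alpha>\<in>UNIV. v $ \<alpha> *\<^sub>R axis \<alpha> 1)"
      by (simp add: linear_sum[OF \<open>linear T\<close>] linear_scale[OF \<open>linear T\<close>])
    also have "(\<Sum>\<alpha>\<in>UNIV. v $ \<alpha> *\<^sub>R axis \<alpha> 1) = v"
      by (simp add: vec_eq_iff axis_def if_distrib cong: if_cong)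
    finally show ?thesis
      by (simp add: \<sigma> z_def v_def)
  qed
  moreover have "invariantize act \<rho> (euler \<alpha> LL) n z = R \<alpha> n z" if z: "z \<in> D n" for n z \<alpha>
  proof -
    define g where "g = \<rho> n z"
    define w where "w = diag act g z"
    have "group G" "group_action G U act"
      using assms(1,2) by (auto simp: lie_group_def smooth_action_def)
    have g: "g \<in> carrier G"
      using frame(1)[OF z] by (simp add: g_def)
    have w: "w \<in> D n"
      using diag_frame_domain[OF inv_dom _ g] z by (simp add: w_def assms(7))
    \<comment> \<open>By equivariance the frame is trivial at an invariantized point.\<close>
    have \<rho>_w: "\<rho> n w = \<one>\<^bsub>G\<^esub>"
      using frame(2)[OF z g] group.r_inv[OF \<open>group G\<close> g] by (simp add: w_def g_def)
    have act_one: "act \<one>\<^bsub>G\<^esub> u = u" if "u \<in> U" for u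
      using group_action.id_eq_one[OF \<open>group_action G U act\<close>] that by (metis restrict_apply')
    obtain \<phi> where \<phi>: "(\<phi> has_real_derivative 1) (at 0)"
      and line: "\<And>s. w(0 := w 0 + \<phi> s *\<^sub>R axis \<alpha> 1) \<in> D n"
      and e: "euler \<alpha> LL n w = (\<Sum>\<gamma>\<in>UNIV. R \<gamma> n w *
        vector_derivative (\<lambda>s. act \<one>\<^bsub>G\<^esub> (w 0 + \<phi> s *\<^sub>R axis \<alpha> 1)) (at 0) $ \<gamma>)"
      using test[OF w, of \<alpha>] unfolding \<rho>_w by blast
    have "(\<lambda>s. act \<one>\<^bsub>G\<^esub> (w 0 + \<phi> s *\<^sub>R axis \<alpha> 1)) = (\<lambda>s. w 0 + \<phi> s *\<^sub>R axis \<alpha> 1)"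
      using in_U[OF line] by (simp add: act_one)
    moreover have "((\<lambda>s. w 0 + \<phi> s *\<^sub>R axis \<alpha> 1) has_vector_derivative axis \<alpha> 1) (at 0)"
      using \<phi> by (auto intro!: derivative_eq_intros simp: has_real_derivative_iff_has_vector_derivative)
    ultimately have "euler \<alpha> LL n w = R \<alpha> n w"
      unfolding e by (simp add: vector_derivative_at axis_def if_distrib cong: if_cong)
    moreover have "\<kappa>_jet \<kappa> n w = \<kappa>_jet \<kappa> n z"
      unfolding w_def
      by (rule \<kappa>_jet_invariant[OF _ D_shift[OF z] g]) (use assms(10) in \<open>simp add: generating_invariants_def\<close>)
    ultimately show ?thesis
      by (simp add: invariantize_def w_def g_def R_def in_terms_of_def)
  qed
  ultimately show ?thesis
    unfolding R_def by blast
qed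

end
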